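(* Let $X, Y \subseteq \mathbb{R}$ be Cantor sets. Then there are at most countably many maps $f : X \to Y$ with the following two properties: (i) there is a finite set $F \subseteq X$ such that $f$ is open on $X \setminus F$; and (ii) $f$ extends to a real-analytic function $U \to \mathbb{R}$ on some open neighborhood $U \subseteq \mathbb{R}$ of $X$.
   Context: A Cantor set is a non-empty, compact, totally disconnected set with no isolated points. The map $f$ being open on $X\setminus F$ means that the restriction $f|_{X \setminus F} : X \setminus F \to Y$ is an open map, where $X\setminus F$ and $Y$ carry the subspace topologies from $\mathbb{R}$. The finite set $F$ and the neighborhood $U$ may depend on $f$, and $U$ is not required to be connected. *)

theory Defs
  imports "HOL-Analysis.Analysis"
begin

definition totally_disconnected :: "'a::topological_space set \<Rightarrow> bool"
  where "totally_disconnected S \<longleftrightarrow> (\<forall>C \<in> components S. \<exists>x. C = {x})"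

definition cantor_set :: "'a::topological_space set \<Rightarrow> bool"
  where "cantor_set S \<longleftrightarrow>
    S \<noteq> {} \<and> compact S \<and> totally_disconnected S \<and> (\<forall>x \<in> S. \<not> x isolated_in S)"

(* The ball need not lie in U. For open U this is no restriction: shrinking r puts the ball
   inside U, so only the values of g on U matter. *)
definition real_analytic_on :: "(real \<Rightarrow> real) \<Rightarrow> real set \<Rightarrow> bool"  (infixl \<open>real'_analytic'_on\<close> 50)
  where "g real_analytic_on U \<longleftrightarrow>
    (\<forall>x \<in> U. \<exists>a :: nat \<Rightarrow> real. \<exists>r > 0. \<forall>y \<in> ball x r. (\<lambda>n. a n * (y - x) ^ n) sums g y)"

end

theory Submission
  imports Defs
begin

text \<open>
  The proof is local and dynamical. Let \<open>z\<close> be a point of \<open>X\<close> that is the right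
  end of a gap of \<open>X\<close> (or its minimum), and consider analytic germs \<open>f\<close> at
  \<open>z\<close> with \<open>f' z > 0\<close> and a fixed value at \<open>z\<close> that map \<open>X\<close>
  near \<open>z\<close> onto a neighbourhood of the value in \<open>Y\<close>. Such germs carry gaps of \<open>X\<close>
  to gaps of \<open>Y\<close>. If \<open>f1 < f2\<close> are two of them, \<open>f2\<^sup>-\<^sup>1 \<circ> f1\<close> is a contraction towards
  \<open>z\<close> that preserves \<open>X\<close>, and its iterates carry a gap of \<open>X\<close> to
  gaps accumulating at \<open>z\<close>. By bounded distortion their lengths stay comparable
  to the displacement of the contraction, that is, to \<open>f2 - f1\<close> (\<open>exists_shrinking_gaps\<close>).

  If the family of germs is uncountable, choose \<open>f1\<close> and \<open>f2\<close> to differ at the least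
  possible order \<open>k\<close> of the Taylor expansion. By uncountability there are also two different germs
  \<open>u < v\<close> whose coefficients of order \<open>k\<close> are as close as desired, so that \<open>v - u\<close>
  is at most a tiny multiple of \<open>f2 - f1\<close>. But then, for a gap from \<open>p\<close> to \<open>q\<close> of the
  sequence above that is close to \<open>z\<close>, the point \<open>u q\<close> of \<open>Y\<close> lies strictly between
  \<open>v p\<close> and \<open>v q\<close>, although these bound a gap of \<open>Y\<close>. So there are only
  countably many germs (\<open>countable_germs_at_point\<close>). Decreasing germs are handled by a reflection, and the
  values at \<open>z\<close> form a countable set (\<open>countable_germs\<close>).

  A map as in the theorem has, on every open interval that meets \<open>X\<close> and on which it extends
  analytically, such a germ with nonzero slope at some \<open>z\<close> of this kind
  (\<open>exists_regular_left_end\<close>), and the germ determines the map on that interval. There are only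
  countably many such \<open>z\<close>, so on each interval only countably many restrictions occur
  (\<open>countable_restrictions\<close>). By compactness the whole map is described by its restrictions to
  finitely many rational intervals.
\<close>

section \<open>Power series expansions\<close>

text \<open>
  The coefficient sequence is an explicit argument because the argument below compares
  coefficients of different functions at one point.
\<close>

definition expands_at :: "(real \<Rightarrow> real) \<Rightarrow> real \<Rightarrow> (nat \<Rightarrow> real) \<Rightarrow> bool"
  where "expands_at g z a \<longleftrightarrow> (\<exists>r>0. \<forall>h. \<bar>h\<bar> < r \<longrightarrow> (\<lambda>n. a n * h ^ n) sums g (z + h))"

lemma real_analytic_on_iff_expands_at:
  "g real_analytic_on U \<longleftrightarrow> (\<forall>x\<in>U. \<exists>a. expands_at g x a)"
proof -
  have "(\<forall>y \<in> ball x r. (\<lambda>n. a n * (y - x) ^ n) sums g y) \<longleftrightarrow>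
        (\<forall>h. \<bar>h\<bar> < r \<longrightarrow> (\<lambda>n. a n * h ^ n) sums g (x + h))" for a r x
  proof safe
    fix h assume "\<forall>y \<in> ball x r. (\<lambda>n. a n * (y - x) ^ n) sums g y" "\<bar>h\<bar> < r"
    then show "(\<lambda>n. a n * h ^ n) sums g (x + h)"
      by (auto dest!: bspec[of _ _ "x + h"] simp: dist_real_def)
  next
    fix y assume "\<forall>h. \<bar>h\<bar> < r \<longrightarrow> (\<lambda>n. a n * h ^ n) sums g (x + h)" "y \<in> ball x r"
    then show "(\<lambda>n. a n * (y - x) ^ n) sums g y"
      by (auto dest!: spec[of _ "y - x"] simp: dist_real_def abs_minus_commute)
  qed
  then show ?thesis
    unfolding real_analytic_on_def expands_at_def by simp
qed

lemma expands_at_diff: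
  assumes "expands_at f z a" "expands_at g z b"
  shows "expands_at (\<lambda>x. f x - g x) z (\<lambda>n. a n - b n)"
proof -
  obtain r s where "r > 0" "\<forall>h. \<bar>h\<bar> < r \<longrightarrow> (\<lambda>n. a n * h ^ n) sums f (z + h)"
    "s > 0" "\<forall>h. \<bar>h\<bar> < s \<longrightarrow> (\<lambda>n. b n * h ^ n) sums g (z + h)"
    using assms unfolding expands_at_def by auto
  then show ?thesis unfolding expands_at_def
    by (intro exI[of _ "min r s"]) (auto intro!: sums_diff simp: left_diff_distrib)
qed

lemma expands_at_uminus:
  assumes "expands_at f z a"
  shows "expands_at (\<lambda>x. - f x) z (\<lambda>n. - a n)"
proof -
  have "expands_at (\<lambda>_. 0) z (\<lambda>_. 0)" unfolding expands_at_def by (auto intro: exI[of _ 1])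
  from expands_at_diff[OF this assms] show ?thesis by simp
qed

lemma expands_at_value: "expands_at g z a \<Longrightarrow> g z = a 0"
  unfolding expands_at_def using powser_sums_zero_iff[of a "g z"] by (metis abs_zero add.right_neutral)

lemma eventually_nhds_shift_iff:
  fixes z :: real
  shows "(\<forall>\<^sub>F x in nhds z. P x) \<longleftrightarrow> (\<exists>r>0. \<forall>h. \<bar>h\<bar> < r \<longrightarrow> P (z + h))"
proof -
  have "(\<forall>y. dist y z < r \<longrightarrow> P y) \<longleftrightarrow> (\<forall>h. \<bar>h\<bar> < r \<longrightarrow> P (z + h))" for r
    by (metis abs_minus_commute add_diff_cancel_left' diff_add_cancel dist_real_def add.commute)
  then show ?thesis unfolding eventually_nhds_metric by simp
qed

text \<open>
  Dividing the series by \<open>h ^ k\<close> leaves a convergent power series with constant term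
  \<open>a k\<close>. Applied to a difference of two functions this turns a comparison of coefficients
  into a comparison of values.
\<close>

lemma expands_at_leading_limit:
  assumes "expands_at g z a" "\<And>i. i < k \<Longrightarrow> a i = 0"
  shows "((\<lambda>x. g x / (x - z) ^ k) \<longlongrightarrow> a k) (at z)"
proof -
  obtain r where r: "r > 0" "\<And>h. \<bar>h\<bar> < r \<Longrightarrow> (\<lambda>n. a n * h ^ n) sums g (z + h)"
    using assms(1) unfolding expands_at_def by auto
  have "((\<lambda>h. g (z + h) / h ^ k) \<longlongrightarrow> a (0 + k)) (at 0)"
  proof (rule powser_limit_0_strong[OF r(1), where a = "\<lambda>n. a (n + k)"])
    fix h :: real assume h: "h \<noteq> 0" "norm h < r"
    have "(\<lambda>n. a (n + k) * h ^ (n + k)) sums g (z + h)"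
      using sums_iff_shift'[of "\<lambda>n. a n * h ^ n" k "g (z + h)"] r(2)[of h] h assms(2) by simp
    from sums_divide[OF this, of "h ^ k"] h
    show "(\<lambda>n. a (n + k) * h ^ n) sums (g (z + h) / h ^ k)"
      by (simp add: power_add)
  qed
  then show ?thesis
    by (subst LIM_offset_zero_iff) (simp_all add: algebra_simps)
qed

lemma expands_at_zero:
  assumes "expands_at g z a" "\<And>i. a i = 0"
  shows "\<forall>\<^sub>F x in nhds z. g x = 0"
  using assms unfolding expands_at_def eventually_nhds_shift_iff
  by (auto simp: sums_iff)

lemma expands_at_leading_term:
  assumes "expands_at g z a" "a i \<noteq> 0"
  obtains k where "a k \<noteq> 0" "((\<lambda>x. g x / (x - z) ^ k) \<longlongrightarrow> a k) (at z)"
proof -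
  define k where "k = (LEAST i. a i \<noteq> 0)"
  have k: "a k \<noteq> 0" "\<And>i. i < k \<Longrightarrow> a i = 0"
    using LeastI[of "\<lambda>i. a i \<noteq> 0", OF assms(2)] not_less_Least unfolding k_def by auto
  show thesis
    using that[OF k(1) expands_at_leading_limit[OF assms(1) k(2)]] by blast
qed

lemma expands_at_nonzero:
  assumes "expands_at g z a" "a i \<noteq> 0"
  shows "\<forall>\<^sub>F x in at z. g x \<noteq> 0"
proof -
  obtain k where k: "a k \<noteq> 0" "((\<lambda>x. g x / (x - z) ^ k) \<longlongrightarrow> a k) (at z)"
    by (rule expands_at_leading_term[OF assms])
  from k(2) have "\<forall>\<^sub>F x in at z. g x / (x - z) ^ k \<noteq> 0"
    using k(1) by (rule tendsto_imp_eventually_ne)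
  then show ?thesis by eventually_elim auto
qed

text \<open>
  Zeros of an analytic function that accumulate at a point force all coefficients there to vanish:
  otherwise the first nonzero term dominates nearby.
\<close>

lemma expands_at_frequently_zero:
  assumes "expands_at g z a" "\<exists>\<^sub>F x in at z. g x = 0"
  shows "\<forall>\<^sub>F x in nhds z. g x = 0"
  using assms expands_at_zero expands_at_nonzero unfolding frequently_def by blast

lemma expands_at_derivative:
  assumes "expands_at g z a"
  obtains g' where "\<forall>\<^sub>F x in nhds z. (g has_real_derivative g' x) (at x)"
    "expands_at g' z (diffs a)"
proof -
  obtain r where r: "r > 0" "\<And>h. \<bar>h\<bar> < r \<Longrightarrow> (\<lambda>n. a n * h ^ n) sums g (z + h)"
    using assms(1) unfolding expands_at_def by auto
  define g' where "g' x = (\<Sum>n. diffs a n * (x - z) ^ n)" for x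
  have sm: "summable (\<lambda>n. a n * h ^ n)" if "\<bar>h\<bar> < r" for h
    using r(2)[OF that] by (rule sums_summable)
  have der: "(g has_real_derivative g' x) (at x)" if x: "\<bar>x - z\<bar> < r" for x
  proof -
    have "((\<lambda>h. \<Sum>n. a n * h ^ n) has_real_derivative g' x) (at (x - z))"
      unfolding g'_def using sm x by (intro termdiffs_strong'[where K = r]) auto
    then have "((\<lambda>y. \<Sum>n. a n * (y - z) ^ n) has_real_derivative g' x) (at x)"
      using DERIV_shift[of "\<lambda>h. \<Sum>n. a n * h ^ n" "g' x" x "-z"] by simp
    moreover have "\<forall>\<^sub>F y in nhds x. (\<Sum>n. a n * (y - z) ^ n) = g y"
    proof -
      have "\<forall>\<^sub>F y in nhds x. y \<in> ball z r"
        using x by (intro eventually_nhds_in_open) (auto simp: dist_real_def)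
      then show ?thesis
      proof eventually_elim
        case (elim y)
        then have "(\<lambda>n. a n * (y - z) ^ n) sums g (z + (y - z))"
          by (intro r(2)) (auto simp: dist_real_def)
        then show ?case by (simp add: sums_iff)
      qed
    qed
    ultimately show ?thesis
      using DERIV_cong_ev[of x x "\<lambda>y. \<Sum>n. a n * (y - z) ^ n" g "g' x" "g' x"] by simp
  qed
  show thesis
  proof
    show "\<forall>\<^sub>F x in nhds z. (g has_real_derivative g' x) (at x)"
      unfolding eventually_nhds_shift_iff using r(1) der by (intro exI[of _ r]) auto
    have "(\<lambda>n. diffs a n * h ^ n) sums g' (z + h)" if "\<bar>h\<bar> < r" for h
      unfolding g'_def using termdiff_converges[of h r a] sm that by (simp add: summable_sums)
    then show "expands_at g' z (diffs a)"
      unfolding expands_at_def using r(1) by blast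
  qed
qed

lemma expands_at_isCont: "expands_at g z a \<Longrightarrow> isCont g z"
  using expands_at_derivative[of g z a] DERIV_isCont eventually_nhds_x_imp_x by metis

text \<open>
  The points near which two analytic functions agree form a set that is open by definition. It is
  closed because at a limit point of it the zeros of the difference accumulate.
\<close>

lemma real_analytic_identity:
  assumes I: "open I" "connected I" and f: "f real_analytic_on I" and g: "g real_analytic_on I"
    and z: "z \<in> I" and ev: "\<forall>\<^sub>F x in nhds z. f x = g x" and x: "x \<in> I"
  shows "f x = g x"
proof -
  define Z where "Z = {y \<in> I. \<forall>\<^sub>F x in nhds y. f x = g x}"
  have "openin (top_of_set I) Z"
  proof -
    have "open {y. \<forall>\<^sub>F x in nhds y. f x = g x}"
    proof (subst open_subopen, safe)
      fix y assume "\<forall>\<^sub>F x in nhds y. f x = g x"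
      then obtain T where T: "open T" "y \<in> T" "\<forall>x\<in>T. f x = g x"
        unfolding eventually_nhds by auto
      then show "\<exists>T. open T \<and> y \<in> T \<and> T \<subseteq> {y. \<forall>\<^sub>F x in nhds y. f x = g x}"
        by (intro exI[of _ T]) (auto simp: eventually_nhds)
    qed
    then show ?thesis unfolding Z_def
      by (auto simp: openin_open)
  qed
  moreover have "closedin (top_of_set I) Z"
    unfolding closedin_limpt
  proof (intro conjI allI impI)
    show "Z \<subseteq> I" by (auto simp: Z_def)
    fix y assume y: "y islimpt Z \<and> y \<in> I"
    obtain a b where ab: "expands_at f y a" "expands_at g y b"
      using f g y unfolding real_analytic_on_iff_expands_at by blast
    have "\<exists>\<^sub>F x in at y. x \<in> Z"
      using y by (simp add: islimpt_conv_frequently_at)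
    then have "\<exists>\<^sub>F x in at y. f x - g x = 0"
      by (rule frequently_elim1) (auto simp: Z_def dest: eventually_nhds_x_imp_x)
    then have "\<forall>\<^sub>F x in nhds y. f x - g x = 0"
      by (rule expands_at_frequently_zero[OF expands_at_diff[OF ab]])
    then show "y \<in> Z" using y by (simp add: Z_def)
  qed
  moreover have "z \<in> Z" using z ev by (simp add: Z_def)
  ultimately have "Z = I"
    using I(2) unfolding connected_clopen by blast
  then show ?thesis using x unfolding Z_def by (auto dest: eventually_nhds_x_imp_x)
qed

text \<open>
  The local facts that the dynamics needs. The last estimate, a Lipschitz bound for the logarithm
  of the derivative, is the source of bounded distortion; it holds because the derivative is bounded
  away from \<open>0\<close> and the second derivative is bounded.
\<close>

lemma expands_at_regular:
  assumes g: "expands_at g z a" and pos: "a 1 > 0"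
  obtains \<delta> D C L where "\<delta> > 0" "C > 0" "L > 0"
    "\<And>x. \<bar>x - z\<bar> < \<delta> \<Longrightarrow> (g has_real_derivative D x) (at x)"
    "\<And>x. \<bar>x - z\<bar> < \<delta> \<Longrightarrow> a 1 / 2 \<le> D x"
    "\<And>x. \<bar>x - z\<bar> < \<delta> \<Longrightarrow> D x \<le> C"
    "\<And>x y. \<bar>x - z\<bar> < \<delta> \<Longrightarrow> \<bar>y - z\<bar> < \<delta> \<Longrightarrow> D x \<le> D y * exp (L * \<bar>x - y\<bar>)"
proof -
  obtain D where D: "\<forall>\<^sub>F x in nhds z. (g has_real_derivative D x) (at x)" "expands_at D z (diffs a)"
    using expands_at_derivative[OF g] .
  obtain E where E: "\<forall>\<^sub>F x in nhds z. (D has_real_derivative E x) (at x)" 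
      "expands_at E z (diffs (diffs a))"
    using expands_at_derivative[OF D(2)] .
  have Dz: "D z = a 1" using expands_at_value[OF D(2)] by (simp add: diffs_def)
  have cont: "(D \<longlongrightarrow> D z) (nhds z)" "(E \<longlongrightarrow> E z) (nhds z)"
    using expands_at_isCont[OF D(2)] expands_at_isCont[OF E(2)]
    by (auto simp: isCont_def tendsto_at_iff_tendsto_nhds)
  define B where "B = \<bar>E z\<bar> + 1"
  have "\<forall>\<^sub>F x in nhds z. (g has_real_derivative D x) (at x) \<and> (D has_real_derivative E x) (at x) \<and>
     a 1 / 2 < D x \<and> D x < 2 * a 1 \<and> \<bar>E x\<bar> < B"
    using D(1) E(1) order_tendstoD(1)[OF cont(1), of "a 1 / 2"]
      order_tendstoD(2)[OF cont(1), of "2 * a 1"]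
      order_tendstoD(2)[OF tendsto_rabs[OF cont(2)], of B] pos
    by (intro eventually_conj) (simp_all add: Dz B_def)
  then obtain \<delta> where \<delta>: "\<delta> > 0" and near: "\<And>x. \<bar>x - z\<bar> < \<delta> \<Longrightarrow>
      (g has_real_derivative D x) (at x) \<and> (D has_real_derivative E x) (at x) \<and>
     a 1 / 2 < D x \<and> D x < 2 * a 1 \<and> \<bar>E x\<bar> < B"
    unfolding eventually_nhds_metric dist_real_def by blast
  show thesis
  proof (rule that[of \<delta> "2 * a 1" "2 * B / a 1" D])
    show "\<delta> > 0" "2 * a 1 > 0" "2 * B / a 1 > 0" using \<delta> pos by (auto simp: B_def)
    show "(g has_real_derivative D x) (at x)" "a 1 / 2 \<le> D x" "D x \<le> 2 * a 1"
      if "\<bar>x - z\<bar> < \<delta>" for x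
      using near[OF that] by auto
    fix x y assume x: "\<bar>x - z\<bar> < \<delta>" and y: "\<bar>y - z\<bar> < \<delta>"
    have "norm (D x - D y) \<le> B * norm (x - y)"
    proof (rule field_differentiable_bound[where S = "ball z \<delta>"])
      fix w assume "w \<in> ball z \<delta>"
      then have "\<bar>w - z\<bar> < \<delta>" by (simp add: dist_real_def abs_minus_commute)
      with near[OF this] show "(D has_real_derivative E w) (at w within ball z \<delta>)" "norm (E w) \<le> B"
        by (auto intro: has_field_derivative_at_within)
    qed (use x y in \<open>auto simp: dist_real_def\<close>)
    then have "D x \<le> D y + B * \<bar>x - y\<bar>" by simp
    also have "\<dots> \<le> D y * (1 + 2 * B / a 1 * \<bar>x - y\<bar>)"
    proof -
      have "B * \<bar>x - y\<bar> * (a 1 / 2) \<le> B * \<bar>x - y\<bar> * D y"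
        using near[OF y] by (intro mult_left_mono) (auto simp: B_def)
      then show ?thesis using pos by (simp add: field_simps)
    qed
    also have "\<dots> \<le> D y * exp (2 * B / a 1 * \<bar>x - y\<bar>)"
      using near[OF y] pos by (intro mult_left_mono) auto
    finally show "D x \<le> D y * exp (2 * B / a 1 * \<bar>x - y\<bar>)" .
  qed
qed


text \<open>
  The first nonzero term decides the sign. Applied to differences this makes analytic germs on the
  right of a point linearly ordered.
\<close>

lemma expands_at_sign:
  assumes "expands_at g z a" "a i \<noteq> 0"
  shows "(\<forall>\<^sub>F x in at_right z. g x > 0) \<or> (\<forall>\<^sub>F x in at_right z. g x < 0)"
proof -
  obtain k where k: "a k \<noteq> 0" "((\<lambda>x. g x / (x - z) ^ k) \<longlongrightarrow> a k) (at z)"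
    by (rule expands_at_leading_term[OF assms])
  from k(2) have lim: "((\<lambda>x. g x / (x - z) ^ k) \<longlongrightarrow> a k) (at_right z)"
    by (simp add: filterlim_at_split)
  have right: "\<forall>\<^sub>F x in at_right z. x > z" by (simp add: eventually_at_filter)
  show ?thesis
  proof (cases "a k > 0")
    case True
    from order_tendstoD(1)[OF lim this] right have "\<forall>\<^sub>F x in at_right z. g x > 0"
      by eventually_elim (simp add: zero_less_divide_iff)
    then show ?thesis ..
  next
    case False
    with k(1) have "a k < 0" by simp
    from order_tendstoD(2)[OF lim this] right have "\<forall>\<^sub>F x in at_right z. g x < 0"
      by eventually_elim (simp add: divide_less_0_iff)
    then show ?thesis ..
  qed
qed

section \<open>Gaps and bounded distortion\<close>

text \<open>
  The map sends points of \<open>X\<close> near \<open>z\<close> into \<open>Y\<close> and is open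
  at \<open>z\<close> as a map from \<open>X\<close> to \<open>Y\<close>. This is all of openness that the
  local argument uses, and it is stated for a function on the whole line so that analytic extensions
  can be treated directly.
\<close>

definition maps_locally_onto :: "(real \<Rightarrow> real) \<Rightarrow> real \<Rightarrow> real set \<Rightarrow> real set \<Rightarrow> bool"
  where "maps_locally_onto g z X Y \<longleftrightarrow>
    (\<forall>\<^sub>F x in nhds z. x \<in> X \<longrightarrow> g x \<in> Y) \<and>
    (\<forall>\<epsilon>>0. \<forall>\<^sub>F y in nhds (g z). y \<in> Y \<longrightarrow> (\<exists>x\<in>X. \<bar>x - z\<bar> < \<epsilon> \<and> g x = y))"

lemma expands_at_strict_mono:
  assumes g: "expands_at g z a" and pos: "a 1 > 0"
  obtains \<delta> where "\<delta> > 0" 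
    "\<And>x y. \<bar>x - z\<bar> < \<delta> \<Longrightarrow> \<bar>y - z\<bar> < \<delta> \<Longrightarrow> g x < g y \<longleftrightarrow> x < y"
proof -
  obtain \<delta> D where \<delta>: "\<delta> > 0"
    "\<And>x. \<bar>x - z\<bar> < \<delta> \<Longrightarrow> (g has_real_derivative D x) (at x)"
    "\<And>x. \<bar>x - z\<bar> < \<delta> \<Longrightarrow> a 1 / 2 \<le> D x"
    by (rule expands_at_regular[OF g pos]) blast
  have mono: "g x < g y" if "x < y" "\<bar>x - z\<bar> < \<delta>" "\<bar>y - z\<bar> < \<delta>" for x y
  proof (rule DERIV_pos_imp_increasing[OF that(1)])
    fix t assume "x \<le> t" "t \<le> y"
    with that have "\<bar>t - z\<bar> < \<delta>" by linarith
    with \<delta>(2,3)[OF this] pos show "\<exists>D. (g has_real_derivative D) (at t) \<and> 0 < D"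
      by (intro exI[of _ "D t"]) auto
  qed
  show thesis
  proof (rule that[OF \<delta>(1)])
    fix x y assume "\<bar>x - z\<bar> < \<delta>" "\<bar>y - z\<bar> < \<delta>"
    then show "g x < g y \<longleftrightarrow> x < y"
      using mono[of x y] mono[of y x] by (cases x y rule: linorder_cases) auto
  qed
qed

text \<open>
  A locally onto increasing map sends gaps of \<open>X\<close> to gaps of \<open>Y\<close>: a
  point of \<open>Y\<close> between the images of the ends has a preimage in \<open>X\<close>, which
  monotonicity puts inside the gap.
\<close>

lemma no_image_in_gap:
  assumes g: "expands_at g z a" and pos: "a 1 > 0" and onto: "maps_locally_onto g z X Y"
  shows "\<exists>\<delta>>0. \<forall>p q y. \<bar>p - z\<bar> < \<delta> \<longrightarrow> \<bar>q - z\<bar> < \<delta> \<longrightarrow> {p<..<q} \<inter> X = {} \<longrightarrow> y \<in> Y \<longrightarrow>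
           \<not> (g p < y \<and> y < g q)"
proof -
  obtain \<rho> where \<rho>: "\<rho> > 0" and mono:
      "\<And>x y. \<bar>x - z\<bar> < \<rho> \<Longrightarrow> \<bar>y - z\<bar> < \<rho> \<Longrightarrow> g x < g y \<longleftrightarrow> x < y"
    using expands_at_strict_mono[OF g pos] by blast
  have "\<forall>\<^sub>F y in nhds (g z). y \<in> Y \<longrightarrow> (\<exists>x\<in>X. \<bar>x - z\<bar> < \<rho> \<and> g x = y)"
    using onto \<rho> unfolding maps_locally_onto_def by blast
  then obtain e where e: "e > 0"
      "\<And>y. \<bar>y - g z\<bar> < e \<Longrightarrow> y \<in> Y \<Longrightarrow> \<exists>x\<in>X. \<bar>x - z\<bar> < \<rho> \<and> g x = y"
    unfolding eventually_nhds_metric dist_real_def by blast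
  have "isCont g z" using expands_at_isCont[OF g] .
  then obtain \<delta> where \<delta>: "\<delta> > 0" "\<And>x. \<bar>x - z\<bar> < \<delta> \<Longrightarrow> \<bar>g x - g z\<bar> < e"
    using e(1) unfolding continuous_at_eps_delta dist_real_def by blast
  have "\<not> (g p < y \<and> y < g q)"
    if pq: "\<bar>p - z\<bar> < min \<delta> \<rho>" "\<bar>q - z\<bar> < min \<delta> \<rho>" "{p<..<q} \<inter> X = {}" "y \<in> Y" for p q y
  proof
    assume y: "g p < y \<and> y < g q"
    then have "\<bar>y - g z\<bar> < e" using \<delta>(2)[of p] \<delta>(2)[of q] pq by auto
    then obtain x where x: "x \<in> X" "\<bar>x - z\<bar> < \<rho>" "g x = y" using e(2) pq(4) by blast
    then have "p < x" "x < q" using mono[of p x] mono[of x q] pq y by auto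
    then show False using pq(3) x(1) by auto
  qed
  then show ?thesis using \<delta>(1) \<rho> by (intro exI[of _ "min \<delta> \<rho>"]) auto
qed

text \<open>
  Bounded distortion for the iterates of \<open>f2\<^sup>-\<^sup>1 \<circ> f1\<close>, phrased without the
  inverse function: \<open>p\<close> and \<open>q\<close> are orbits, \<open>l\<close> in the proof is the length of the interval
  between them and \<open>d\<close> is the distance from \<open>q\<close> to its next iterate. By the mean
  value theorem one step multiplies both by quotients of derivatives taken at points at most
  \<open>d\<close> apart, so the ratio of \<open>l\<close> to \<open>d\<close> loses at most a factor \<open>exp\<close> of
  \<open>L\<close> times two consecutive values of \<open>d\<close>. The sum of
  all displacements telescopes and is finite because the orbit is bounded below, so the ratio stays
  away from \<open>0\<close>.
\<close>

lemma gap_ratio_bound: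
  fixes p q :: "nat \<Rightarrow> real"
  assumes J: "is_interval J"
    and der1: "\<And>x. x \<in> J \<Longrightarrow> (f1 has_real_derivative D1 x) (at x)"
    and der2: "\<And>x. x \<in> J \<Longrightarrow> (f2 has_real_derivative D2 x) (at x)"
    and pos1: "\<And>x. x \<in> J \<Longrightarrow> D1 x > 0" and pos2: "\<And>x. x \<in> J \<Longrightarrow> D2 x > 0"
    and dist1: "\<And>x y. x \<in> J \<Longrightarrow> y \<in> J \<Longrightarrow> D1 x \<le> D1 y * exp (L * \<bar>x - y\<bar>)"
    and dist2: "\<And>x y. x \<in> J \<Longrightarrow> y \<in> J \<Longrightarrow> D2 x \<le> D2 y * exp (L * \<bar>x - y\<bar>)"
    and L: "L \<ge> 0"
    and inJ: "\<And>m. p m \<in> J" "\<And>m. q m \<in> J" and low: "\<And>m. z \<le> q m"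
    and ord: "\<And>m. q (Suc m) \<le> p m" "\<And>m. p m < q m"
    and step: "\<And>m. f2 (p (Suc m)) = f1 (p m)" "\<And>m. f2 (q (Suc m)) = f1 (q m)"
  shows "\<exists>\<kappa>>0. \<forall>m. \<kappa> * (q m - q (Suc m)) \<le> q m - p m"
proof -
  define d where "d m = q m - q (Suc m)" for m
  define l where "l m = q m - p m" for m
  have d: "d m > 0" for m using ord[of m] unfolding d_def by linarith
  have l: "l m > 0" for m using ord[of m] unfolding l_def by linarith
  have btw: "t \<in> J" if "x \<le> t" "t \<le> y" "x \<in> J" "y \<in> J" for t x y :: real
    using J that unfolding is_interval_1 by blast
  have mvt: "\<exists>t. x < t \<and> t < y \<and> t \<in> J \<and> f y - f x = (y - x) * D t"
    if "x < y" "x \<in> J" "y \<in> J" "\<And>x. x \<in> J \<Longrightarrow> (f has_real_derivative D x) (at x)" for x y and f D :: "real \<Rightarrow> real"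
  proof -
    have "\<exists>t>x. t < y \<and> f y - f x = (y - x) * D t"
      using that(1) by (rule MVT2) (use btw that in blast)
    then show ?thesis using btw[of x _ y] that by (meson less_imp_le)
  qed
  have key: "l m * d (Suc m) \<le> l (Suc m) * d m * exp (L * (d m + d (Suc m)))" for m
  proof -
    obtain t1 where t1: "p m < t1" "t1 < q m" "t1 \<in> J" "f1 (q m) - f1 (p m) = l m * D1 t1"
      using mvt[OF ord(2) inJ(1) inJ(2) der1, of m] unfolding l_def by blast
    obtain t2 where t2: "p (Suc m) < t2" "t2 < q (Suc m)" "t2 \<in> J"
        "f2 (q (Suc m)) - f2 (p (Suc m)) = l (Suc m) * D2 t2"
      using mvt[OF ord(2) inJ(1) inJ(2) der2, of "Suc m"] unfolding l_def by blast
    have dec: "q (Suc m) < q m" for m using d[of m] unfolding d_def by simp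
    obtain s1 where s1: "q (Suc m) < s1" "s1 < q m" "s1 \<in> J" "f1 (q m) - f1 (q (Suc m)) = d m * D1 s1"
      using mvt[OF dec inJ(2) inJ(2) der1, of m] unfolding d_def by blast
    obtain s2 where s2: "q (Suc (Suc m)) < s2" "s2 < q (Suc m)" "s2 \<in> J"
        "f2 (q (Suc m)) - f2 (q (Suc (Suc m))) = d (Suc m) * D2 s2"
      using mvt[OF dec inJ(2) inJ(2) der2, of "Suc m"] unfolding d_def by blast
    have e1: "l m * D1 t1 = l (Suc m) * D2 t2" using t1(4) t2(4) step by simp
    have e2: "d m * D1 s1 = d (Suc m) * D2 s2" using s1(4) s2(4) step by simp
    have "D1 s1 \<le> D1 t1 * exp (L * \<bar>s1 - t1\<bar>)" using dist1 s1 t1 by blast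
    also have "\<dots> \<le> D1 t1 * exp (L * d m)"
      using pos1[OF t1(3)] L s1 t1 ord[of m] unfolding d_def
      by (intro mult_left_mono iffD2[OF exp_le_cancel_iff]) auto
    finally have i1: "D1 s1 \<le> D1 t1 * exp (L * d m)" .
    have "D2 t2 \<le> D2 s2 * exp (L * \<bar>t2 - s2\<bar>)" using dist2 s2 t2 by blast
    also have "\<dots> \<le> D2 s2 * exp (L * d (Suc m))"
      using pos2[OF s2(3)] L s2 t2 ord[of "Suc m"] unfolding d_def
      by (intro mult_left_mono iffD2[OF exp_le_cancel_iff]) auto
    finally have i2: "D2 t2 \<le> D2 s2 * exp (L * d (Suc m))" .
    have "(l m * d (Suc m)) * (D1 t1 * D2 s2) = (l m * D1 t1) * (d (Suc m) * D2 s2)" by simp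
    also have "\<dots> = (l (Suc m) * d m) * (D2 t2 * D1 s1)" unfolding e1 e2[symmetric] by simp
    also have "\<dots> \<le> (l (Suc m) * d m) * ((D2 s2 * exp (L * d (Suc m))) * (D1 t1 * exp (L * d m)))"
      using i1 i2 l[of "Suc m"] d[of m] pos1[OF s1(3)] pos2[OF s2(3)]
      by (intro mult_left_mono mult_mono) auto
    also have "\<dots> = (l (Suc m) * d m * exp (L * (d m + d (Suc m)))) * (D1 t1 * D2 s2)"
      by (simp add: distrib_left exp_add)
    finally show ?thesis
      using pos1[OF t1(3)] pos2[OF s2(3)] by (simp add: mult_le_cancel_right)
  qed
  define s where "s m = q m + q (Suc m)" for m
  \<comment> \<open>The exponential factor absorbs the loss at each step: \<open>s\<close> decreases by
    \<open>d m + d (Suc m)\<close>, so \<open>R\<close> is nondecreasing.\<close>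
  define R where "R m = l m / d m * exp (- L * s m)" for m
  have "R m \<le> R (Suc m)" for m
  proof -
    have "l m / d m \<le> l (Suc m) / d (Suc m) * exp (L * (d m + d (Suc m)))"
      using key[of m] d[of m] d[of "Suc m"] by (simp add: field_simps)
    moreover have "d m + d (Suc m) = s m - s (Suc m)" unfolding d_def s_def by simp
    ultimately have "R m \<le> l (Suc m) / d (Suc m) * exp (L * (s m - s (Suc m))) * exp (- L * s m)"
      unfolding R_def by (intro mult_right_mono) auto
    also have "\<dots> = R (Suc m)"
      unfolding R_def by (simp add: mult.assoc flip: exp_add) (simp add: algebra_simps)
    finally show ?thesis .
  qed
  then have R: "R 0 \<le> R m" for m by (rule lift_Suc_mono_le) simp
  define \<kappa> where "\<kappa> = R 0 * exp (L * (2 * z))"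
  have "\<kappa> > 0" unfolding \<kappa>_def R_def using l d by simp
  moreover have "\<kappa> * d m \<le> l m" for m
  proof -
    have "\<kappa> \<le> R m * exp (L * (2 * z))" unfolding \<kappa>_def using R by simp
    also have "\<dots> \<le> R m * exp (L * s m)"
      using low[of m] low[of "Suc m"] L l[of m] d[of m] unfolding s_def R_def
      by (intro mult_left_mono iffD2[OF exp_le_cancel_iff]) auto
    also have "\<dots> = l m / d m" unfolding R_def by (simp add: mult.assoc flip: exp_add)
    finally show ?thesis using d[of m] by (simp add: field_simps)
  qed
  ultimately show ?thesis unfolding d_def l_def by blast
qed

lemma exists_gap_between:
  fixes X :: "real set"
  assumes "closed X" "y1 \<in> X" "y2 \<in> X" "y1 \<le> t" "t \<le> y2" "t \<notin> X"
  obtains p q where "p \<in> X" "q \<in> X" "y1 \<le> p" "p < q" "q \<le> y2" "{p<..<q} \<inter> X = {}"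
proof -
  define A where "A = X \<inter> {y1..t}"
  define B where "B = X \<inter> {t..y2}"
  have A: "closed A" "A \<noteq> {}" "bdd_above A" and B: "closed B" "B \<noteq> {}" "bdd_below B"
    unfolding A_def B_def using assms by (auto intro: closed_Int)
  have p: "Sup A \<in> A" using closed_contains_Sup[OF A(2,3,1)] .
  have q: "Inf B \<in> B" using closed_contains_Inf[OF B(2,3,1)] .
  have empty: "x \<notin> X" if x: "Sup A < x" "x < Inf B" for x
  proof
    assume "x \<in> X"
    then have "x \<in> A \<or> x \<in> B" using x p q unfolding A_def B_def by auto
    then show False using cSup_upper[OF _ A(3), of x] cInf_lower[OF _ B(3), of x] x by auto
  qed
  have less: "Sup A < Inf B"
  proof -
    have "Sup A \<noteq> t" "Inf B \<noteq> t" using p q assms(6) unfolding A_def B_def by auto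
    then show ?thesis using p q unfolding A_def B_def by auto
  qed
  have "{Sup A<..<Inf B} \<inter> X = {}" using empty by auto
  with less show thesis
    using p q by (intro that[of "Sup A" "Inf B"]) (auto simp: A_def B_def)
qed


text \<open>
  Two increasing germs \<open>f1 < f2\<close> with the same value at \<open>z\<close>, both sending
  \<open>X\<close> locally onto \<open>Y\<close>, produce the contraction \<open>f2\<^sup>-\<^sup>1 \<circ> f1\<close>,
  which preserves \<open>X\<close> on the right of \<open>z\<close>. It carries one gap of
  \<open>X\<close> to a sequence of gaps shrinking to \<open>z\<close>. The last conclusion says that these gaps are
  large: by bounded distortion their length is at least a fixed multiple of the displacement of the
  contraction, and that displacement is comparable to \<open>f2 - f1\<close>.
\<close>

lemma exists_shrinking_gaps:
  fixes X Y :: "real set"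
  assumes X: "closed X" "z islimpt X" "\<And>s t. s < t \<Longrightarrow> \<not> {s..t} \<subseteq> X"
    and left: "\<forall>\<^sub>F x in nhds z. x \<in> X \<longrightarrow> z \<le> x"
    and f1: "expands_at f1 z c1" "c1 1 > 0" "maps_locally_onto f1 z X Y"
    and f2: "expands_at f2 z c2" "c2 1 > 0" "maps_locally_onto f2 z X Y"
    and eq: "f1 z = f2 z" and less: "\<forall>\<^sub>F x in at_right z. f1 x < f2 x"
  obtains K p q where "K > 0" "q \<longlonglongrightarrow> z"
    "\<And>m. z < p m" "\<And>m. p m < q m" "\<And>m. q m \<in> X" "\<And>m. {p m<..<q m} \<inter> X = {}"
    "\<And>m. f2 (q m) - f1 (q m) \<le> K * (q m - p m)"
proof -
  obtain \<delta>1 D1 C1 L1 where \<delta>1: "\<delta>1 > 0" "L1 > 0"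
    "\<And>x. \<bar>x - z\<bar> < \<delta>1 \<Longrightarrow> (f1 has_real_derivative D1 x) (at x)"
    "\<And>x. \<bar>x - z\<bar> < \<delta>1 \<Longrightarrow> c1 1 / 2 \<le> D1 x"
    "\<And>x y. \<bar>x - z\<bar> < \<delta>1 \<Longrightarrow> \<bar>y - z\<bar> < \<delta>1 \<Longrightarrow> D1 x \<le> D1 y * exp (L1 * \<bar>x - y\<bar>)"
    by (rule expands_at_regular[OF f1(1,2)]) blast
  obtain \<delta>2 D2 C L2 where \<delta>2: "\<delta>2 > 0" "L2 > 0" "C > 0"
    "\<And>x. \<bar>x - z\<bar> < \<delta>2 \<Longrightarrow> (f2 has_real_derivative D2 x) (at x)"
    "\<And>x. \<bar>x - z\<bar> < \<delta>2 \<Longrightarrow> c2 1 / 2 \<le> D2 x"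
    "\<And>x. \<bar>x - z\<bar> < \<delta>2 \<Longrightarrow> D2 x \<le> C"
    "\<And>x y. \<bar>x - z\<bar> < \<delta>2 \<Longrightarrow> \<bar>y - z\<bar> < \<delta>2 \<Longrightarrow> D2 x \<le> D2 y * exp (L2 * \<bar>x - y\<bar>)"
    by (rule expands_at_regular[OF f2(1,2)]) blast
  obtain \<delta>3 where \<delta>3: "\<delta>3 > 0"
      "\<And>x y. \<bar>x - z\<bar> < \<delta>3 \<Longrightarrow> \<bar>y - z\<bar> < \<delta>3 \<Longrightarrow> f1 x < f1 y \<longleftrightarrow> x < y"
    by (rule expands_at_strict_mono[OF f1(1,2)]) blast
  obtain \<delta>4 where \<delta>4: "\<delta>4 > 0"
      "\<And>x y. \<bar>x - z\<bar> < \<delta>4 \<Longrightarrow> \<bar>y - z\<bar> < \<delta>4 \<Longrightarrow> f2 x < f2 y \<longleftrightarrow> x < y"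
    by (rule expands_at_strict_mono[OF f2(1,2)]) blast
  obtain \<delta>5 where \<delta>5: "\<delta>5 > 0" "\<And>p q y. \<bar>p - z\<bar> < \<delta>5 \<Longrightarrow> \<bar>q - z\<bar> < \<delta>5 \<Longrightarrow>
      {p<..<q} \<inter> X = {} \<Longrightarrow> y \<in> Y \<Longrightarrow> \<not> (f1 p < y \<and> y < f1 q)"
    using no_image_in_gap[OF f1] by blast
  have "\<forall>\<^sub>F x in nhds z. (x \<in> X \<longrightarrow> z \<le> x) \<and> (x \<in> X \<longrightarrow> f1 x \<in> Y) \<and> (x \<in> X \<longrightarrow> f2 x \<in> Y)"
    using left f1(3) f2(3) unfolding maps_locally_onto_def by (intro eventually_conj) auto
  then obtain \<delta>6 where \<delta>6: "\<delta>6 > 0" "\<And>x. \<bar>x - z\<bar> < \<delta>6 \<Longrightarrow> x \<in> X \<Longrightarrow> z \<le> x \<and> f1 x \<in> Y \<and> f2 x \<in> Y"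
    unfolding eventually_nhds_metric dist_real_def by blast
  obtain \<delta>7 where \<delta>7: "\<delta>7 > 0" "\<And>x. z < x \<Longrightarrow> x < z + \<delta>7 \<Longrightarrow> f1 x < f2 x"
  proof -
    obtain b where "b > z" "\<And>x. z < x \<Longrightarrow> x < b \<Longrightarrow> f1 x < f2 x"
      using less unfolding eventually_at_right_field by blast
    then show thesis by (intro that[of "b - z"]) auto
  qed
  define \<delta> where "\<delta> = Min {\<delta>1, \<delta>2, \<delta>3, \<delta>4, \<delta>5, \<delta>6, \<delta>7}"
  have "\<delta> > 0"
    unfolding \<delta>_def using \<delta>1(1) \<delta>2(1) \<delta>3(1) \<delta>4(1) \<delta>5(1) \<delta>6(1) \<delta>7(1) by simp
  moreover have "\<delta> \<le> \<delta>1" "\<delta> \<le> \<delta>2" "\<delta> \<le> \<delta>3" "\<delta> \<le> \<delta>4" "\<delta> \<le> \<delta>5" "\<delta> \<le> \<delta>6" "\<delta> \<le> \<delta>7"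
    unfolding \<delta>_def by (rule Min_le; simp)+
  ultimately have \<delta>: "\<delta> > 0" "\<delta> \<le> \<delta>1" "\<delta> \<le> \<delta>2" "\<delta> \<le> \<delta>3" "\<delta> \<le> \<delta>4" "\<delta> \<le> \<delta>5" "\<delta> \<le> \<delta>6" "\<delta> \<le> \<delta>7"
    by - assumption
  have "\<forall>\<^sub>F y in nhds (f2 z). y \<in> Y \<longrightarrow> (\<exists>x\<in>X. \<bar>x - z\<bar> < \<delta> \<and> f2 x = y)"
    using f2(3) \<delta>(1) unfolding maps_locally_onto_def by blast
  moreover have "(f1 \<longlongrightarrow> f2 z) (nhds z)"
    using expands_at_isCont[OF f1(1)]
    by (simp add: isCont_def tendsto_at_iff_tendsto_nhds flip: eq)
  ultimately have "\<forall>\<^sub>F t in nhds z. f1 t \<in> Y \<longrightarrow> (\<exists>x\<in>X. \<bar>x - z\<bar> < \<delta> \<and> f2 x = f1 t)"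
    by (rule eventually_compose_filterlim)
  then obtain \<rho>' where \<rho>': "\<rho>' > 0" 
      "\<And>t. \<bar>t - z\<bar> < \<rho>' \<Longrightarrow> f1 t \<in> Y \<Longrightarrow> (\<exists>x\<in>X. \<bar>x - z\<bar> < \<delta> \<and> f2 x = f1 t)"
    unfolding eventually_nhds_metric dist_real_def by blast
  define \<rho> where "\<rho> = min \<rho>' \<delta>"
  have \<rho>: "\<rho> > 0" "\<rho> \<le> \<rho>'" "\<rho> \<le> \<delta>" unfolding \<rho>_def using \<rho>' \<delta> by auto
  define P where "P = X \<inter> {z<..<z + \<rho>}"
  \<comment> \<open>The contraction exists on \<open>P\<close> because \<open>f1\<close> maps into \<open>Y\<close> and
    \<open>f2\<close> is onto.\<close>
  have "\<exists>x'\<in>P. x' < x \<and> f2 x' = f1 x" if "x \<in> P" for x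
  proof -
    have x: "x \<in> X" "\<bar>x - z\<bar> < \<rho>" "z < x" using that unfolding P_def by auto
    then obtain x' where x': "x' \<in> X" "\<bar>x' - z\<bar> < \<delta>" "f2 x' = f1 x"
      using \<rho>'(2)[of x] \<delta>6(2)[of x] \<rho> \<delta> by auto
    have "f2 x' < f2 x" using x x' \<delta>7(2)[of x] \<rho> \<delta> by auto
    then have "x' < x" using \<delta>4(2)[of x' x] x x' \<rho> \<delta> by auto
    moreover have "f2 z < f2 x'" using x x'(3) eq \<delta>3(2)[of z x] \<rho> \<delta> by auto
    then have "z < x'" using \<delta>4(2)[of z x'] x' \<rho> \<delta> by auto
    ultimately show ?thesis using x x' unfolding P_def by auto
  qed
  then obtain g where g: "\<And>x. x \<in> P \<Longrightarrow> g x \<in> P" "\<And>x. x \<in> P \<Longrightarrow> g x < x"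
      "\<And>x. x \<in> P \<Longrightarrow> f2 (g x) = f1 x"
    by metis
  have P: "\<bar>x - z\<bar> < \<rho>" "z < x" "x \<in> X" if "x \<in> P" for x using that unfolding P_def by auto
  have g_mono: "g x < g y" if "x < y" "x \<in> P" "y \<in> P" for x y
    using that \<delta>3(2)[of x y] \<delta>4(2)[of "g x" "g y"] g P[of x] P[of y] P[of "g x"] P[of "g y"] \<rho> \<delta>
    by auto
  have g_gap: "{g x<..<g y} \<inter> X = {}" if xy: "x < y" "x \<in> P" "y \<in> P" "{x<..<y} \<inter> X = {}" for x y
  proof (rule ccontr)
    assume "{g x<..<g y} \<inter> X \<noteq> {}"
    then obtain t where t: "g x < t" "t < g y" "t \<in> X" by auto
    have near: "\<bar>g x - z\<bar> < \<rho>" "\<bar>g y - z\<bar> < \<rho>" "\<bar>x - z\<bar> < \<rho>" "\<bar>y - z\<bar> < \<rho>"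
      using P(1) g(1) xy(2,3) by auto
    then have t': "\<bar>t - z\<bar> < \<rho>" using t(1,2) by linarith
    then have "f2 t \<in> Y" "f2 (g x) < f2 t" "f2 t < f2 (g y)"
      using \<delta>6(2)[of t] \<delta>4(2)[of "g x" t] \<delta>4(2)[of t "g y"] t near \<rho> \<delta> by auto
    then show False using \<delta>5(2)[of x y "f2 t"] near \<rho> \<delta> xy g(3) by auto
  qed
  obtain y2 where y2: "y2 \<in> P"
  proof -
    obtain y where "y \<in> X" "y \<noteq> z" "\<bar>y - z\<bar> < \<rho>"
      using X(2) \<rho>(1) unfolding islimpt_approachable dist_real_def by blast
    then show thesis using that[of y] \<delta>6(2)[of y] \<rho> \<delta> unfolding P_def by auto
  qed
  obtain y1 where y1: "y1 \<in> P" "y1 < y2"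
  proof -
    have "y2 - z > 0" using P(2)[OF y2] by simp
    then obtain y where "y \<in> X" "y \<noteq> z" "\<bar>y - z\<bar> < y2 - z"
      using X(2) unfolding islimpt_approachable dist_real_def by blast
    then show thesis using that[of y] \<delta>6(2)[of y] P(1,2)[OF y2] \<rho> \<delta> unfolding P_def by auto
  qed
  obtain t where t: "t \<notin> X" "y1 \<le> t" "t \<le> y2" using X(3)[OF y1(2)] unfolding subset_iff atLeastAtMost_iff by blast
  obtain p0 q0 where pq0: "p0 \<in> X" "q0 \<in> X" "y1 \<le> p0" "p0 < q0" "q0 \<le> y2" "{p0<..<q0} \<inter> X = {}"
    by (rule exists_gap_between[OF X(1) P(3)[OF y1(1)] P(3)[OF y2] t(2,3,1)])
  have pq0P: "p0 \<in> P" "q0 \<in> P" using pq0 y1(1) y2 unfolding P_def by auto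
  define p where "p m = (g ^^ m) p0" for m
  define q where "q m = (g ^^ m) q0" for m
  have pS: "p (Suc m) = g (p m)" and qS: "q (Suc m) = g (q m)" for m
    unfolding p_def q_def by simp_all
  have inv: "p m \<in> P \<and> q m \<in> P \<and> p m < q m \<and> {p m<..<q m} \<inter> X = {}" for m
  proof (induction m)
    case 0 then show ?case using pq0 pq0P unfolding p_def q_def by simp
  next
    case (Suc m) then show ?case unfolding pS qS using g(1) g_mono g_gap by blast
  qed
  have q_dec: "q (Suc m) < q m" for m unfolding qS using g(2) inv by blast
  have q_le_p: "q (Suc m) \<le> p m" for m
  proof (rule ccontr)
    assume "\<not> q (Suc m) \<le> p m"
    then have "q (Suc m) \<in> {p m<..<q m} \<inter> X" using q_dec[of m] inv[of "Suc m"] P(3) by auto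
    then show False using inv[of m] by blast
  qed
  define J where "J = {z<..<z + \<rho>}"
  have J: "\<bar>x - z\<bar> < \<delta>1" "\<bar>x - z\<bar> < \<delta>2" "\<bar>x - z\<bar> < \<rho>" if "x \<in> J" for x
    using that \<rho> \<delta> unfolding J_def by auto
  define L where "L = max L1 L2"
  have "\<exists>\<kappa>>0. \<forall>m. \<kappa> * (q m - q (Suc m)) \<le> q m - p m"
  proof (rule gap_ratio_bound[where J = J and z = z and L = L])
    show "is_interval J" unfolding J_def by (simp add: is_interval_1)
    show "(f1 has_real_derivative D1 x) (at x)" "(f2 has_real_derivative D2 x) (at x)"
      "D1 x > 0" "D2 x > 0" if "x \<in> J" for x
      using \<delta>1(3,4)[of x] \<delta>2(4,5)[of x] J[OF that] f1(2) f2(2) by auto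
    show "D1 x \<le> D1 y * exp (L * \<bar>x - y\<bar>)" if "x \<in> J" "y \<in> J" for x y
    proof -
      have "D1 x \<le> D1 y * exp (L1 * \<bar>x - y\<bar>)" using \<delta>1(5) J that by blast
      also have "\<dots> \<le> D1 y * exp (L * \<bar>x - y\<bar>)"
        using \<delta>1(4)[of y] J(1)[OF that(2)] f1(2)
        by (intro mult_left_mono iffD2[OF exp_le_cancel_iff] mult_right_mono) (auto simp: L_def)
      finally show ?thesis .
    qed
    show "D2 x \<le> D2 y * exp (L * \<bar>x - y\<bar>)" if "x \<in> J" "y \<in> J" for x y
    proof -
      have "D2 x \<le> D2 y * exp (L2 * \<bar>x - y\<bar>)" using \<delta>2(7) J that by blast
      also have "\<dots> \<le> D2 y * exp (L * \<bar>x - y\<bar>)"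
        using \<delta>2(5)[of y] J(2)[OF that(2)] f2(2)
        by (intro mult_left_mono iffD2[OF exp_le_cancel_iff] mult_right_mono) (auto simp: L_def)
      finally show ?thesis .
    qed
    show "L \<ge> 0" using \<delta>1(2) unfolding L_def by auto
    show "p m \<in> J" "q m \<in> J" "z \<le> q m" "q (Suc m) \<le> p m" "p m < q m"
      "f2 (p (Suc m)) = f1 (p m)" "f2 (q (Suc m)) = f1 (q m)" for m
      using inv[of m] q_le_p[of m] g(3) unfolding P_def J_def pS qS by auto
  qed
  then obtain \<kappa> where \<kappa>: "\<kappa> > 0" "\<And>m. \<kappa> * (q m - q (Suc m)) \<le> q m - p m" by blast
  have qP: "z < q m" "\<bar>q m - z\<bar> < \<rho>" for m using inv[of m] P by auto
  have bound: "f2 (q m) - f1 (q m) \<le> C / \<kappa> * (q m - p m)" for m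
  proof -
    have "\<exists>t>q (Suc m). t < q m \<and> f2 (q m) - f2 (q (Suc m)) = (q m - q (Suc m)) * D2 t"
    proof (rule MVT2[OF q_dec])
      fix x assume "q (Suc m) \<le> x" "x \<le> q m"
      then have "\<bar>x - z\<bar> < \<delta>2" using qP[of m] qP[of "Suc m"] \<rho> \<delta> by auto
      then show "(f2 has_real_derivative D2 x) (at x)" by (rule \<delta>2(4))
    qed
    then obtain t where t: "q (Suc m) < t" "t < q m"
        "f2 (q m) - f2 (q (Suc m)) = (q m - q (Suc m)) * D2 t" by blast
    have "\<bar>t - z\<bar> < \<delta>2" using t(1,2) qP[of m] qP[of "Suc m"] \<rho> \<delta> by auto
    then have "(q m - q (Suc m)) * D2 t \<le> (q m - q (Suc m)) * C"
      using \<delta>2(6) q_dec[of m] by (intro mult_left_mono) auto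
    also have "\<dots> \<le> C / \<kappa> * (q m - p m)" 
    proof -
      have "q m - q (Suc m) \<le> (q m - p m) / \<kappa>" using \<kappa> by (simp add: pos_le_divide_eq mult.commute)
      from mult_right_mono[OF this, of C] show ?thesis using \<delta>2(3) by (simp add: mult.commute)
    qed
    finally show ?thesis using t(3) g(3)[of "q m"] inv[of m] unfolding qS by simp
  qed
  have "decseq q" using q_dec by (intro decseq_SucI) (auto intro: less_imp_le)
  moreover have "\<forall>m. z \<le> q m" using qP(1) less_imp_le by blast
  ultimately obtain l where l: "q \<longlonglongrightarrow> l" "\<And>m. l \<le> q m"
    using decseq_convergent[of q z] by blast
  have "z \<le> l" using LIMSEQ_le_const[OF l(1)] qP(1) less_imp_le by blast
  \<comment> \<open>A limit to the right of \<open>z\<close> would be a fixed point of the contraction.\<close>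
  have "l = z"
  proof (rule ccontr)
    assume "l \<noteq> z"
    with \<open>z \<le> l\<close> have "z < l" by simp
    have l_near: "\<bar>l - z\<bar> < \<rho>" using l(2)[of 0] qP[of 0] \<open>z < l\<close> by auto
    have "isCont f1 l" "isCont f2 l"
      using DERIV_isCont[OF \<delta>1(3)[of l]] DERIV_isCont[OF \<delta>2(4)[of l]] l_near \<rho> \<delta> by auto
    then have "(\<lambda>m. f1 (q m)) \<longlonglongrightarrow> f1 l" "(\<lambda>m. f2 (q (Suc m))) \<longlonglongrightarrow> f2 l"
      using l(1) LIMSEQ_Suc[OF l(1)] by (auto intro: isCont_tendsto_compose)
    moreover have "f2 (q (Suc m)) = f1 (q m)" for m unfolding qS using g(3) inv by blast
    ultimately have "f1 l = f2 l" using LIMSEQ_unique by auto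
    then show False using \<delta>7(2)[of l] \<open>z < l\<close> l_near \<rho> \<delta> by auto
  qed
  show thesis
  proof (rule that[of "C / \<kappa>" q p])
    show "C / \<kappa> > 0" using \<kappa> \<delta>2(3) by simp
    show "q \<longlonglongrightarrow> z" using l \<open>l = z\<close> by simp
    show "z < p m" "p m < q m" "q m \<in> X" "{p m<..<q m} \<inter> X = {}" for m
      using inv[of m] P by auto
    show "f2 (q m) - f1 (q m) \<le> C / \<kappa> * (q m - p m)" for m by (rule bound)
  qed
qed


section \<open>Countability of germs\<close>

lemma uncountable_close_pair:
  fixes c :: "'i \<Rightarrow> real"
  assumes "uncountable S" "e > 0"
  obtains i j where "i \<in> S" "j \<in> S" "i \<noteq> j" "\<bar>c i - c j\<bar> < e"
proof -
  have "\<not> inj_on (\<lambda>i. \<lfloor>c i / e\<rfloor>) S"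
    using assms(1) countableI' by blast
  then obtain i j where ij: "i \<in> S" "j \<in> S" "i \<noteq> j" "\<lfloor>c i / e\<rfloor> = \<lfloor>c j / e\<rfloor>"
    unfolding inj_on_def by blast
  then have "\<bar>c i / e - c j / e\<bar> < 1" by linarith
  then have "\<bar>c i - c j\<bar> < e"
    using assms(2) by (simp add: flip: diff_divide_distrib)
  with ij(1-3) show thesis by (rule that)
qed

text \<open>
  The rigidity argument. Let \<open>k\<close> be the least order at which two members of an uncountable
  family differ. A pair \<open>i1\<close>, \<open>i2\<close> that differs at order \<open>k\<close> yields gaps of
  \<open>X\<close> near \<open>z\<close> whose length is at least a fixed multiple of
  \<open>G i2 - G i1\<close>, hence at least of the order of \<open>(x - z) ^ k\<close>. 
  Among uncountably many members there are \<open>i\<close> and \<open>j\<close> whose coefficients of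
  order \<open>k\<close> are so close that \<open>G j - G i\<close> is far smaller than the images of these gaps. Since the germs are
  comparable, one may take \<open>G i < G j\<close>. Then \<open>G i\<close> sends the right end of a late
  gap to a point of \<open>Y\<close> strictly inside the image of the gap under \<open>G j\<close>, which
  is a gap of \<open>Y\<close>.
\<close>

lemma countable_germs_at_point:
  fixes X Y :: "real set" and G :: "'i \<Rightarrow> real \<Rightarrow> real"
  assumes X: "closed X" "z islimpt X" "\<And>s t. s < t \<Longrightarrow> \<not> {s..t} \<subseteq> X"
    and left: "\<forall>\<^sub>F x in nhds z. x \<in> X \<longrightarrow> z \<le> x"
    and G: "\<And>i. i \<in> S \<Longrightarrow> expands_at (G i) z (c i)" "\<And>i. i \<in> S \<Longrightarrow> c i 1 > 0"
      "\<And>i. i \<in> S \<Longrightarrow> maps_locally_onto (G i) z X Y" "\<And>i. i \<in> S \<Longrightarrow> G i z = w"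
    and distinct: "\<And>i j. i \<in> S \<Longrightarrow> j \<in> S \<Longrightarrow> i \<noteq> j \<Longrightarrow> \<not> (\<forall>\<^sub>F x in nhds z. G i x = G j x)"
  shows "countable S"
proof (rule ccontr)
  assume unc: "uncountable S"
  \<comment> \<open>A uniform lower bound \<open>e\<close> for the slopes must be fixed before the close pair is
    chosen, since the required closeness depends on it.\<close>
  have "S = (\<Union>n. {i \<in> S. c i 1 > inverse (real (Suc n))})"
    using G(2) reals_Archimedean by blast
  then obtain n where "uncountable {i \<in> S. c i 1 > inverse (real (Suc n))}"
    using unc countable_UN[of UNIV "\<lambda>n. {i \<in> S. c i 1 > inverse (real (Suc n))}"] by force
  then obtain e T where T: "uncountable T" "T \<subseteq> S" and e: "e > 0" "\<And>i. i \<in> T \<Longrightarrow> c i 1 > e"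
    by (rule_tac that[of "{i \<in> S. c i 1 > inverse (real (Suc n))}" "inverse (real (Suc n))"]) auto
  have GT: "expands_at (G i) z (c i)" "c i 1 > 0" "maps_locally_onto (G i) z X Y" "G i z = w"
    if "i \<in> T" for i using that T(2) G by auto
  have diff_coeff: "\<exists>k. c i k \<noteq> c j k" if "i \<in> T" "j \<in> T" "i \<noteq> j" for i j
  proof (rule ccontr)
    assume "\<nexists>k. c i k \<noteq> c j k"
    then have "\<forall>\<^sub>F x in nhds z. G i x - G j x = 0"
      using expands_at_zero[OF expands_at_diff[OF GT(1)[OF that(1)] GT(1)[OF that(2)]]] by simp
    then show False using distinct[of i j] that T(2) by auto
  qed
  define k where "k = (LEAST k. \<exists>i\<in>T. \<exists>j\<in>T. c i k < c j k)"
  have "\<exists>k. \<exists>i\<in>T. \<exists>j\<in>T. c i k < c j k"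
  proof -
    obtain i j where "i \<in> T" "j \<in> T" "i \<noteq> j"
      using uncountable_close_pair[OF T(1), of 1] by (metis zero_less_one)
    moreover from this obtain k where "c i k \<noteq> c j k" using diff_coeff by blast
    ultimately show ?thesis unfolding neq_iff by blast
  qed
  then have "\<exists>i\<in>T. \<exists>j\<in>T. c i k < c j k" unfolding k_def by (rule LeastI_ex)
  then obtain i1 i2 where i12: "i1 \<in> T" "i2 \<in> T" "c i1 k < c i2 k" by blast
  have agree: "c i l = c j l" if "i \<in> T" "j \<in> T" "l < k" for i j l
  proof -
    have "\<not> c i l < c j l" "\<not> c j l < c i l"
      using not_less_Least[OF that(3)[unfolded k_def]] that(1,2) by blast+
    then show ?thesis by simp
  qed
  have lim: "((\<lambda>x. (G j x - G i x) / (x - z) ^ k) \<longlongrightarrow> c j k - c i k) (at_right z)"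
    if "i \<in> T" "j \<in> T" for i j
  proof -
    have "c j l - c i l = 0" if "l < k" for l
      using agree[of j i l] that \<open>i \<in> T\<close> \<open>j \<in> T\<close> by simp
    from expands_at_leading_limit[OF expands_at_diff[OF GT(1)[OF that(2)] GT(1)[OF that(1)]] this]
    show ?thesis by (simp add: filterlim_at_split)
  qed
  have right: "\<forall>\<^sub>F x in at_right z. x > z" by (simp add: eventually_at_filter)
  have less12: "\<forall>\<^sub>F x in at_right z. G i1 x < G i2 x"
  proof -
    have "\<forall>\<^sub>F x in at_right z. 0 < (G i2 x - G i1 x) / (x - z) ^ k"
      using i12(3) by (intro order_tendstoD(1)[OF lim[OF i12(1,2)]]) simp
    with right show ?thesis by eventually_elim (simp add: zero_less_divide_iff)
  qed
  obtain K p q where K: "K > 0" and q: "q \<longlonglongrightarrow> z" and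
    pq: "\<And>m. z < p m" "\<And>m. p m < q m" "\<And>m. q m \<in> X" "\<And>m. {p m<..<q m} \<inter> X = {}"
    "\<And>m. G i2 (q m) - G i1 (q m) \<le> K * (q m - p m)"
  proof -
    have eq12: "G i1 z = G i2 z" using GT(4) i12 by simp
    show thesis
      by (rule exists_shrinking_gaps[OF X left GT(1-3)[OF i12(1)] GT(1-3)[OF i12(2)] eq12 less12])
        (assumption, rule that)
  qed
  \<comment> \<open>At \<open>q m\<close> with \<open>m\<close> large this makes \<open>G j - G i\<close> less than \<open>e / 4\<close> times the length of the
    gap, while \<open>G j\<close> stretches the gap by at least \<open>e / 2\<close>.\<close>
  define \<eta> where "\<eta> = e / (4 * K)"
  define d where "d = c i2 k - c i1 k"
  have pos: "\<eta> > 0" "d > 0" unfolding \<eta>_def d_def using e(1) K i12(3) by auto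
  obtain i j where ij: "i \<in> T" "j \<in> T" "\<bar>c j k - c i k\<bar> < \<eta> * d"
      and less: "\<forall>\<^sub>F x in at_right z. G i x < G j x"
  proof -
    obtain i j where ij: "i \<in> T" "j \<in> T" "i \<noteq> j" "\<bar>c i k - c j k\<bar> < \<eta> * d"
      using uncountable_close_pair[OF T(1), of "\<eta> * d" "\<lambda>i. c i k"] pos by auto
    obtain l where "c j l - c i l \<noteq> 0" using diff_coeff[OF ij(1-3)] by force
    from expands_at_sign[OF expands_at_diff[OF GT(1)[OF ij(2)] GT(1)[OF ij(1)]], OF this]
    show thesis using that[of i j] that[of j i] ij by (auto simp: abs_minus_commute)
  qed
  have close: "\<forall>\<^sub>F x in at_right z. G j x - G i x < \<eta> * (G i2 x - G i1 x)"
  proof -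
    have "((\<lambda>x. \<eta> * ((G i2 x - G i1 x) / (x - z) ^ k) - (G j x - G i x) / (x - z) ^ k)
            \<longlongrightarrow> \<eta> * d - (c j k - c i k)) (at_right z)"
      unfolding d_def by (intro tendsto_intros lim i12 ij)
    from order_tendstoD(1)[OF this, of 0] ij(3)
    have "\<forall>\<^sub>F x in at_right z. 0 < \<eta> * ((G i2 x - G i1 x) / (x - z) ^ k) - (G j x - G i x) / (x - z) ^ k"
      by auto
    with right show ?thesis
    proof eventually_elim
      case (elim x)
      then have "0 < (\<eta> * (G i2 x - G i1 x) - (G j x - G i x)) / (x - z) ^ k"
        by (simp add: diff_divide_distrib right_diff_distrib)
      then show ?case using elim(1) by (simp add: zero_less_divide_iff)
    qed
  qed
  obtain \<delta>1 D where \<delta>1: "\<delta>1 > 0"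
    "\<And>x. \<bar>x - z\<bar> < \<delta>1 \<Longrightarrow> (G j has_real_derivative D x) (at x)"
    "\<And>x. \<bar>x - z\<bar> < \<delta>1 \<Longrightarrow> c j 1 / 2 \<le> D x"
    by (rule expands_at_regular[OF GT(1,2)[OF ij(2)]]) blast
  obtain \<delta>2 where \<delta>2: "\<delta>2 > 0" "\<And>p q y. \<bar>p - z\<bar> < \<delta>2 \<Longrightarrow> \<bar>q - z\<bar> < \<delta>2 \<Longrightarrow>
      {p<..<q} \<inter> X = {} \<Longrightarrow> y \<in> Y \<Longrightarrow> \<not> (G j p < y \<and> y < G j q)"
    using no_image_in_gap[OF GT(1-3)[OF ij(2)]] by blast
  have q_right: "filterlim q (at_right z) sequentially"
  proof -
    have "z < q m" for m using pq(1)[of m] pq(2)[of m] by linarith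
    then show ?thesis using q by (simp add: filterlim_at less_imp_neq[symmetric])
  qed
  have "\<forall>\<^sub>F m in sequentially. G i (q m) < G j (q m) \<and>
      G j (q m) - G i (q m) < \<eta> * (G i2 (q m) - G i1 (q m)) \<and>
      \<bar>q m - z\<bar> < \<delta>1 \<and> \<bar>q m - z\<bar> < \<delta>2 \<and> (q m \<in> X \<longrightarrow> G i (q m) \<in> Y)"
  proof (intro eventually_conj)
    show "\<forall>\<^sub>F m in sequentially. \<bar>q m - z\<bar> < \<delta>1" "\<forall>\<^sub>F m in sequentially. \<bar>q m - z\<bar> < \<delta>2"
      using tendstoD[OF q \<delta>1(1)] tendstoD[OF q \<delta>2(1)] by (simp_all add: dist_real_def)
    show "\<forall>\<^sub>F m in sequentially. q m \<in> X \<longrightarrow> G i (q m) \<in> Y"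
      using GT(3)[OF ij(1)] unfolding maps_locally_onto_def
      by (auto intro: eventually_compose_filterlim[OF _ q])
  qed (intro eventually_compose_filterlim[OF less q_right] eventually_compose_filterlim[OF close q_right])+
  then obtain m where m: "G i (q m) < G j (q m)" 
      "G j (q m) - G i (q m) < \<eta> * (G i2 (q m) - G i1 (q m))"
      "\<bar>q m - z\<bar> < \<delta>1" "\<bar>q m - z\<bar> < \<delta>2" "G i (q m) \<in> Y"
    using pq(3) by (auto dest!: eventually_happens)
  have near: "\<bar>t - z\<bar> < \<delta>1 \<and> \<bar>t - z\<bar> < \<delta>2" if "p m \<le> t" "t \<le> q m" for t
    using that pq(1)[of m] m(3,4) by auto
  have "\<exists>t>p m. t < q m \<and> G j (q m) - G j (p m) = (q m - p m) * D t"
    using pq(2) by (rule MVT2) (use near \<delta>1(2) in blast)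
  then obtain t where t: "p m < t" "t < q m" "G j (q m) - G j (p m) = (q m - p m) * D t" by blast
  have "G j (q m) - G i (q m) < \<eta> * (K * (q m - p m))"
    using m(2) mult_left_mono[OF pq(5)[of m] less_imp_le[OF pos(1)]] by linarith
  also have "\<dots> \<le> (q m - p m) * (e / 2)"
    unfolding \<eta>_def using K e(1) pq(2)[of m] by (simp add: field_simps)
  also have "\<dots> \<le> (q m - p m) * D t"
    using \<delta>1(3)[of t] near[of t] t(1,2) e(2)[OF ij(2)] by (intro mult_left_mono) auto
  finally have "G j (p m) < G i (q m)" using t(3) by simp
  then show False
    using \<delta>2(2)[of "p m" "q m" "G i (q m)"] near[of "p m"] near[of "q m"] pq(2,4)[of m] m(1,5)
    by (simp add: less_imp_le)
qed


text \<open>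
  For closed \<open>X\<close> these are the right ends of its gaps together with its minimum: the points
  from which \<open>X\<close> continues only to the right.
\<close>

definition left_ends :: "real set \<Rightarrow> real set"
  where "left_ends X = {z \<in> X. \<forall>\<^sub>F x in nhds z. x \<in> X \<longrightarrow> z \<le> x}"

text \<open>
  A rational number in the gap to the left of each such point separates it from the others.
\<close>

lemma countable_left_ends: "countable (left_ends X)"
proof -
  have "\<exists>r\<in>\<rat>. r < z \<and> {r<..<z} \<inter> X = {}" if z: "z \<in> left_ends X" for z
  proof -
    obtain \<delta> where "\<delta> > 0" "\<And>x. dist x z < \<delta> \<Longrightarrow> x \<in> X \<Longrightarrow> z \<le> x"
      using z unfolding left_ends_def eventually_nhds_metric by blast
    moreover obtain r where "r \<in> \<rat>" "z - \<delta> < r" "r < z"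
      using Rats_dense_in_real[of "z - \<delta>" z] \<open>\<delta> > 0\<close> by auto
    ultimately show ?thesis by (intro bexI[of _ r]) (force simp: dist_real_def)+
  qed
  then obtain r where r: "\<And>z. z \<in> left_ends X \<Longrightarrow> r z \<in> \<rat>" "\<And>z. z \<in> left_ends X \<Longrightarrow> r z < z"
      "\<And>z. z \<in> left_ends X \<Longrightarrow> {r z<..<z} \<inter> X = {}"
    by metis
  have "r y < r z" if "y < z" "y \<in> left_ends X" "z \<in> left_ends X" for y z
  proof -
    have "y \<notin> {r z<..<z}" using r(3)[OF that(3)] that(2) unfolding left_ends_def by blast
    then show ?thesis using that r(2)[of y] by auto
  qed
  then have "inj_on r (left_ends X)"
    by (intro inj_onI) (metis linorder_neqE_linordered_idom order_less_irrefl)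
  moreover have "countable (r ` left_ends X)"
    using countable_subset[OF _ countable_rat] r(1) by blast
  ultimately show ?thesis by (rule countable_image_inj_on[rotated])
qed

text \<open>
  Points of \<open>Y\<close> near \<open>g z\<close> are images of points of \<open>X\<close> near
  \<open>z\<close>, and none of these lies to the left of \<open>z\<close>. So the value at
  \<open>z\<close> ranges over a countable set, which reduces a family of germs to families with a common value.
\<close>

lemma left_ends_image:
  assumes g: "expands_at g z a" "a 1 > 0" "maps_locally_onto g z X Y" and z: "z \<in> left_ends X"
  shows "g z \<in> left_ends Y"
proof -
  obtain \<delta> where \<delta>: "\<delta> > 0" "\<And>x y. \<bar>x - z\<bar> < \<delta> \<Longrightarrow> \<bar>y - z\<bar> < \<delta> \<Longrightarrow> g x < g y \<longleftrightarrow> x < y"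
    by (rule expands_at_strict_mono[OF g(1,2)]) blast
  obtain \<delta>' where \<delta>': "\<delta>' > 0" "\<And>x. dist x z < \<delta>' \<Longrightarrow> x \<in> X \<Longrightarrow> z \<le> x"
    using z unfolding left_ends_def eventually_nhds_metric by blast
  have "g z \<in> Y"
    using g(3) z unfolding maps_locally_onto_def left_ends_def
    by (auto dest: eventually_nhds_x_imp_x)
  moreover have "\<forall>\<^sub>F y in nhds (g z). y \<in> Y \<longrightarrow> (\<exists>x\<in>X. \<bar>x - z\<bar> < min \<delta> \<delta>' \<and> g x = y)"
  proof -
    have "min \<delta> \<delta>' > 0" using \<delta>(1) \<delta>'(1) by simp
    then show ?thesis using g(3) unfolding maps_locally_onto_def by blast
  qed
  then have "\<forall>\<^sub>F y in nhds (g z). y \<in> Y \<longrightarrow> g z \<le> y"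
  proof eventually_elim
    case (elim y)
    show ?case
    proof
      assume "y \<in> Y"
      with elim obtain x where x: "x \<in> X" "\<bar>x - z\<bar> < \<delta>" "\<bar>x - z\<bar> < \<delta>'" "g x = y" by auto
      then have "\<not> x < z" using \<delta>'(2)[of x] by (auto simp: dist_real_def)
      then show "g z \<le> y" using \<delta>(2)[of x z] \<delta>(1) x by auto
    qed
  qed
  ultimately show ?thesis unfolding left_ends_def by blast
qed

text \<open>
  Decreasing germs become increasing when negated, with \<open>Y\<close> replaced by its reflection.
\<close>

lemma countable_germs:
  fixes X Y :: "real set" and G :: "'i \<Rightarrow> real \<Rightarrow> real"
  assumes X: "closed X" "z islimpt X" "\<And>s t. s < t \<Longrightarrow> \<not> {s..t} \<subseteq> X"
    and z: "z \<in> left_ends X"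
    and G: "\<And>i. i \<in> S \<Longrightarrow> expands_at (G i) z (c i)" "\<And>i. i \<in> S \<Longrightarrow> c i 1 \<noteq> 0"
      "\<And>i. i \<in> S \<Longrightarrow> maps_locally_onto (G i) z X Y"
    and distinct: "\<And>i j. i \<in> S \<Longrightarrow> j \<in> S \<Longrightarrow> i \<noteq> j \<Longrightarrow> \<not> (\<forall>\<^sub>F x in nhds z. G i x = G j x)"
  shows "countable S"
proof -
  have increasing: "countable R"
    if R: "\<And>i. i \<in> R \<Longrightarrow> expands_at (H i) z (d i)" "\<And>i. i \<in> R \<Longrightarrow> d i 1 > 0"
      "\<And>i. i \<in> R \<Longrightarrow> maps_locally_onto (H i) z X Z"
      "\<And>i j. i \<in> R \<Longrightarrow> j \<in> R \<Longrightarrow> i \<noteq> j \<Longrightarrow> \<not> (\<forall>\<^sub>F x in nhds z. H i x = H j x)"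
    for R :: "'i set" and H d Z
  proof -
    have "R \<subseteq> (\<Union>w\<in>left_ends Z. {i \<in> R. H i z = w})"
      using left_ends_image[OF R(1-3) z] by auto
    moreover have "countable {i \<in> R. H i z = w}" for w
    proof (rule countable_germs_at_point[OF X, where G = H and c = d and Y = Z and w = w])
      show "\<forall>\<^sub>F x in nhds z. x \<in> X \<longrightarrow> z \<le> x" using z by (simp add: left_ends_def)
    qed (use R in auto)
    then have "countable (\<Union>w\<in>left_ends Z. {i \<in> R. H i z = w})"
      by (intro countable_UN countable_left_ends)
    ultimately show ?thesis by (rule countable_subset)
  qed
  have pos: "countable {i \<in> S. c i 1 > 0}"
    by (rule increasing[where H = G and d = c and Z = Y]) (use G distinct in auto)
  have neg: "countable {i \<in> S. c i 1 < 0}"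
  proof (rule increasing[where H = "\<lambda>i x. - G i x" and d = "\<lambda>i n. - c i n" and Z = "uminus ` Y"])
    fix i assume i: "i \<in> {i \<in> S. c i 1 < 0}"
    show "expands_at (\<lambda>x. - G i x) z (\<lambda>n. - c i n)" using expands_at_uminus[OF G(1)] i by blast
    show "- c i 1 > 0" using i by simp
    show "maps_locally_onto (\<lambda>x. - G i x) z X (uminus ` Y)"
      unfolding maps_locally_onto_def
    proof (intro conjI allI impI)
      show "\<forall>\<^sub>F x in nhds z. x \<in> X \<longrightarrow> - G i x \<in> uminus ` Y"
        using G(3)[of i] i unfolding maps_locally_onto_def by (auto elim: eventually_mono)
      fix \<epsilon> :: real assume "\<epsilon> > 0"
      then have "\<forall>\<^sub>F y in nhds (G i z). y \<in> Y \<longrightarrow> (\<exists>x\<in>X. \<bar>x - z\<bar> < \<epsilon> \<and> G i x = y)"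
        using G(3)[of i] i unfolding maps_locally_onto_def by auto
      moreover have "(uminus \<longlongrightarrow> G i z) (nhds (- G i z))"
        using tendsto_minus[OF filterlim_ident[of "nhds (- G i z)"]] by simp
      ultimately have "\<forall>\<^sub>F y in nhds (- G i z). - y \<in> Y \<longrightarrow> (\<exists>x\<in>X. \<bar>x - z\<bar> < \<epsilon> \<and> G i x = - y)"
        by (rule eventually_compose_filterlim)
      then show "\<forall>\<^sub>F y in nhds (- G i z). y \<in> uminus ` Y \<longrightarrow> (\<exists>x\<in>X. \<bar>x - z\<bar> < \<epsilon> \<and> - G i x = y)"
        by eventually_elim auto
    qed
  qed (use distinct in auto)
  have "S \<subseteq> {i \<in> S. c i 1 > 0} \<union> {i \<in> S. c i 1 < 0}" using G(2) by force
  then show ?thesis by (rule countable_subset[OF _ countable_Un[OF pos neg]])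
qed

section \<open>Cantor sets\<close>

lemma cantor_set_facts:
  fixes X :: "real set"
  assumes "cantor_set X"
  shows cantor_set_closed: "closed X" and cantor_set_perfect: "x \<in> X \<Longrightarrow> x islimpt X"
    and cantor_set_no_interval: "s < t \<Longrightarrow> \<not> {s..t} \<subseteq> X"
proof -
  show "closed X" using assms by (simp add: cantor_set_def compact_imp_closed)
  show "x islimpt X" if "x \<in> X"
    using assms that by (auto simp: cantor_set_def isolated_in_islimpt_iff)
  show "\<not> {s..t} \<subseteq> X" if "s < t"
  proof
    assume sub: "{s..t} \<subseteq> X"
    have "X \<noteq> {}" using sub that by force
    then obtain C where C: "C \<in> components X" "{s..t} \<subseteq> C"
      using exists_component_superset[OF sub _ connected_Icc] that sub by auto
    then obtain x where "C = {x}"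
      using assms unfolding cantor_set_def totally_disconnected_def by blast
    moreover have "s \<in> C" "t \<in> C" using C(2) that by auto
    ultimately show False using that by simp
  qed
qed

text \<open>
  Between two close points of \<open>X\<close> there is a gap, and its right end is such a point.
\<close>

lemma left_ends_dense:
  fixes X :: "real set"
  assumes X: "cantor_set X" and x: "x \<in> X" and U: "open U" "x \<in> U"
  obtains z where "z \<in> left_ends X" "z \<in> U"
proof -
  obtain r where r: "r > 0" "ball x r \<subseteq> U" using U open_contains_ball by blast
  obtain y where y: "y \<in> X" "y \<noteq> x" "dist y x < r"
    using cantor_set_perfect[OF X x] r(1) unfolding islimpt_approachable by blast
  define s t where "s = min x y" and "t = max x y"
  have st: "s < t" "s \<in> X" "t \<in> X" "{s..t} \<subseteq> ball x r"
    unfolding s_def t_def using x y r(1)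
    by (cases x y rule: linorder_cases; auto simp: dist_real_def)+
  obtain u where u: "u \<notin> X" "s \<le> u" "u \<le> t"
    using cantor_set_no_interval[OF X st(1)] unfolding subset_iff atLeastAtMost_iff by blast
  obtain p q where pq: "p \<in> X" "q \<in> X" "s \<le> p" "p < q" "q \<le> t" "{p<..<q} \<inter> X = {}"
    by (rule exists_gap_between[OF cantor_set_closed[OF X] st(2,3) u(2,3,1)])
  have "\<forall>\<^sub>F x in nhds q. x \<in> {p<..}"
    using pq(4) by (intro eventually_nhds_in_open) auto
  then have "\<forall>\<^sub>F x in nhds q. x \<in> X \<longrightarrow> q \<le> x"
    by eventually_elim (use pq(6) in force)
  then have "q \<in> left_ends X" using pq(2) by (simp add: left_ends_def)
  moreover have "q \<in> {s..t}" using pq by simp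
  then have "q \<in> U" using st(4) r(2) by blast
  ultimately show thesis by (rule that)
qed

text \<open>
  The derivative of the extension cannot vanish identically near a point of \<open>X\<close>: then
  \<open>f\<close> would be constant on a nonempty open part of \<open>X - F\<close>, and openness would
  make its value an isolated point of \<open>Y\<close>. So near a point of \<open>X\<close> critical points are isolated, and density of
  \<open>left_ends X\<close> supplies a point that is neither critical nor in \<open>F\<close>.
\<close>

lemma exists_regular_left_end:
  fixes X Y :: "real set"
  assumes X: "cantor_set X" and Y: "cantor_set Y" and f: "f \<in> X \<rightarrow> Y"
    and F: "finite F" "open_map (top_of_set (X - F)) (top_of_set Y) f"
    and I: "open I" and x: "x \<in> X" "x \<in> I"
    and g: "g real_analytic_on I" "\<And>x. x \<in> X \<Longrightarrow> x \<in> I \<Longrightarrow> g x = f x"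
  shows "\<exists>z\<in>left_ends X \<inter> I. \<exists>c. expands_at g z c \<and> c 1 \<noteq> 0 \<and> maps_locally_onto g z X Y"
proof -
  obtain a where a: "expands_at g x a"
    using g(1) x(2) unfolding real_analytic_on_iff_expands_at by blast
  obtain g' where g': "\<forall>\<^sub>F y in nhds x. (g has_real_derivative g' y) (at y)"
      "expands_at g' x (diffs a)"
    by (rule expands_at_derivative[OF a])
  define V where "V = I - (F - {x})"
  have V: "open V" "x \<in> V" unfolding V_def using I x F(1) by (auto intro!: open_Diff finite_imp_closed)
  have "\<not> (\<forall>\<^sub>F y in nhds x. g' y = 0)"
  proof
    assume "\<forall>\<^sub>F y in nhds x. g' y = 0"
    then have "\<forall>\<^sub>F y in nhds x. (g has_real_derivative g' y) (at y) \<and> g' y = 0 \<and> y \<in> V"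
      using g'(1) eventually_nhds_in_open[OF V] by (intro eventually_conj)
    then obtain r where r: "r > 0" "\<And>y. dist y x < r \<Longrightarrow> (g has_real_derivative g' y) (at y) \<and> g' y = 0 \<and> y \<in> V"
      unfolding eventually_nhds_metric by blast
    obtain k where k: "\<And>y. y \<in> ball x r \<Longrightarrow> g y = k"
    proof -
      have "\<exists>k. \<forall>y\<in>ball x r. g y = k"
      proof (rule has_field_derivative_zero_constant)
        fix y assume "y \<in> ball x r"
        then have "(g has_real_derivative 0) (at y)" using r(2)[of y] by (metis dist_commute mem_ball)
        then show "(g has_real_derivative 0) (at y within ball x r)"
          by (rule has_field_derivative_at_within)
      qed simp
      then show thesis using that by blast
    qed
    define W where "W = (X - F) \<inter> ball x r"
    have "openin (top_of_set (X - F)) W" unfolding W_def by (simp add: openin_open_Int)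
    then have op: "openin (top_of_set Y) (f ` W)" using F(2) unfolding open_map_def by blast
    obtain y where y: "y \<in> X" "y \<noteq> x" "dist y x < r"
      using cantor_set_perfect[OF X x(1)] r(1) unfolding islimpt_approachable by blast
    then have yW: "y \<in> W" using r(2)[of y] unfolding W_def V_def by (auto simp: dist_commute)
    have "f w = k" if "w \<in> W" for w
      using that g(2)[of w] k[of w] r(2)[of w] unfolding W_def V_def by (auto simp: dist_commute)
    then have "f ` W = {k}" using yW by auto
    with op obtain T where "open T" "{k} = Y \<inter> T" unfolding openin_open by metis
    then have "k isolated_in Y" unfolding isolated_in_def by blast
    moreover have "k \<in> Y" using \<open>{k} = Y \<inter> T\<close> by blast
    ultimately show False using Y unfolding cantor_set_def by blast
  qed
  then have "\<forall>\<^sub>F y in at x. g' y \<noteq> 0"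
    using expands_at_frequently_zero[OF g'(2)] unfolding frequently_def by auto
  then have "\<forall>\<^sub>F y in nhds x. (g has_real_derivative g' y) (at y) \<and> (y \<noteq> x \<longrightarrow> g' y \<noteq> 0) \<and> y \<in> V"
    using g'(1) eventually_nhds_in_open[OF V] by (auto simp: eventually_at_filter intro!: eventually_conj)
  then obtain W where W: "open W" "x \<in> W"
      "\<And>y. y \<in> W \<Longrightarrow> (g has_real_derivative g' y) (at y) \<and> (y \<noteq> x \<longrightarrow> g' y \<noteq> 0) \<and> y \<in> V"
    unfolding eventually_nhds by blast
  obtain y where y: "y \<in> X" "y \<in> W" "y \<noteq> x"
    using cantor_set_perfect[OF X x(1)] W(1,2) unfolding islimpt_def by blast
  obtain z where z: "z \<in> left_ends X" "z \<in> W - {x}"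
    by (rule left_ends_dense[OF X y(1), of "W - {x}"]) (use y W in \<open>auto intro: open_delete\<close>)
  have zX: "z \<in> X" and zI: "z \<in> I" and zF: "z \<notin> F"
    using z W(3)[of z] unfolding left_ends_def V_def by auto
  obtain c where c: "expands_at g z c"
    using g(1) zI unfolding real_analytic_on_iff_expands_at by blast
  obtain h where h: "\<forall>\<^sub>F y in nhds z. (g has_real_derivative h y) (at y)" "expands_at h z (diffs c)"
    by (rule expands_at_derivative[OF c])
  have "c 1 = h z" using expands_at_value[OF h(2)] by (simp add: diffs_def)
  also have "\<dots> = g' z"
    using DERIV_unique[OF eventually_nhds_x_imp_x[OF h(1)]] W(3)[of z] z(2) by auto
  finally have "c 1 \<noteq> 0" using W(3)[of z] z(2) by auto
  moreover have "maps_locally_onto g z X Y"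
    unfolding maps_locally_onto_def
  proof (intro conjI allI impI)
    show "\<forall>\<^sub>F x in nhds z. x \<in> X \<longrightarrow> g x \<in> Y"
      using eventually_nhds_in_open[OF I zI] by eventually_elim (use f g(2) in auto)
    fix \<epsilon> :: real assume "\<epsilon> > 0"
    define N where "N = (X - F) \<inter> (ball z \<epsilon> \<inter> I)"
    have "openin (top_of_set (X - F)) N" unfolding N_def using I by (intro openin_open_Int) auto
    then have "openin (top_of_set Y) (f ` N)" using F(2) unfolding open_map_def by blast
    then obtain T where T: "open T" "f ` N = Y \<inter> T" unfolding openin_open by blast
    have "z \<in> N" unfolding N_def using zX zI zF \<open>\<epsilon> > 0\<close> by simp
    then have "g z \<in> T" using T(2) g(2)[OF zX zI] by auto
    from eventually_nhds_in_open[OF T(1) this]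
    show "\<forall>\<^sub>F y in nhds (g z). y \<in> Y \<longrightarrow> (\<exists>x\<in>X. \<bar>x - z\<bar> < \<epsilon> \<and> g x = y)"
    proof eventually_elim
      case (elim y)
      show ?case
      proof
        assume "y \<in> Y"
        then have "y \<in> f ` N" using T(2) elim by blast
        then obtain w where "w \<in> N" "f w = y" by blast
        then show "\<exists>x\<in>X. \<bar>x - z\<bar> < \<epsilon> \<and> g x = y"
          using g(2)[of w] unfolding N_def by (intro bexI[of _ w]) (auto simp: dist_real_def)
      qed
    qed
  qed
  ultimately show ?thesis using z(1) zI c by blast
qed

text \<open>
  On a connected \<open>I\<close> an extension is determined by its germ at one point. For each
  restriction choose that point in the countable set \<open>left_ends X\<close> so that the slope is
  nonzero; for each fixed point only countably many germs occur.
\<close>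

lemma countable_restrictions:
  fixes X Y :: "real set"
  assumes X: "cantor_set X" and Y: "cantor_set Y" and I: "open I" "connected I"
    and T: "\<And>f. f \<in> T \<Longrightarrow> f \<in> X \<rightarrow> Y"
      "\<And>f. f \<in> T \<Longrightarrow> \<exists>F. finite F \<and> open_map (top_of_set (X - F)) (top_of_set Y) f"
      "\<And>f. f \<in> T \<Longrightarrow> \<exists>g. g real_analytic_on I \<and> (\<forall>x \<in> X \<inter> I. g x = f x)"
  shows "countable ((\<lambda>f. restrict f (X \<inter> I)) ` T)"
proof (cases "X \<inter> I = {}")
  case True
  have "(\<lambda>f. restrict f (X \<inter> I)) ` T \<subseteq> {\<lambda>_. undefined}"
    unfolding True by (auto simp: restrict_def)
  then show ?thesis by (rule countable_subset) simp
next
  case False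
  then obtain x where x: "x \<in> X" "x \<in> I" by blast
  define R where "R = (\<lambda>f. restrict f (X \<inter> I)) ` T"
  have ex: "\<exists>g z c. g real_analytic_on I \<and> (\<forall>x \<in> X \<inter> I. g x = \<phi> x) \<and> z \<in> left_ends X \<and> z \<in> I \<and>
          expands_at g z c \<and> c 1 \<noteq> 0 \<and> maps_locally_onto g z X Y" if \<phi>: "\<phi> \<in> R" for \<phi>
  proof -
    obtain f where f: "f \<in> T" "\<phi> = restrict f (X \<inter> I)" using \<phi> unfolding R_def by blast
    obtain F where F: "finite F" "open_map (top_of_set (X - F)) (top_of_set Y) f" using T(2)[OF f(1)] by blast
    obtain g where g: "g real_analytic_on I" "\<And>x. x \<in> X \<Longrightarrow> x \<in> I \<Longrightarrow> g x = f x" using T(3)[OF f(1)] by auto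
    show ?thesis
      using exists_regular_left_end[OF X Y T(1)[OF f(1)] F I(1) x g] g f(2) by auto
  qed
  have "\<exists>G Z C. \<forall>\<phi>\<in>R. G \<phi> real_analytic_on I \<and> (\<forall>x \<in> X \<inter> I. G \<phi> x = \<phi> x) \<and>
          Z \<phi> \<in> left_ends X \<and> Z \<phi> \<in> I \<and> expands_at (G \<phi>) (Z \<phi>) (C \<phi>) \<and> C \<phi> 1 \<noteq> 0 \<and>
          maps_locally_onto (G \<phi>) (Z \<phi>) X Y"
    using ballI[of R, OF ex] unfolding bchoice_iff by assumption
  then obtain G Z C where all: "\<forall>\<phi>\<in>R. G \<phi> real_analytic_on I \<and> (\<forall>x \<in> X \<inter> I. G \<phi> x = \<phi> x) \<and>
          Z \<phi> \<in> left_ends X \<and> Z \<phi> \<in> I \<and> expands_at (G \<phi>) (Z \<phi>) (C \<phi>) \<and> C \<phi> 1 \<noteq> 0 \<and>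
          maps_locally_onto (G \<phi>) (Z \<phi>) X Y"
    by (elim exE)
  have GZC: "G \<phi> real_analytic_on I" "\<forall>x \<in> X \<inter> I. G \<phi> x = \<phi> x" "Z \<phi> \<in> left_ends X"
      "Z \<phi> \<in> I" "expands_at (G \<phi>) (Z \<phi>) (C \<phi>)" "C \<phi> 1 \<noteq> 0"
      "maps_locally_onto (G \<phi>) (Z \<phi>) X Y" if "\<phi> \<in> R" for \<phi>
    using bspec[OF all that] by simp_all
  have "countable {\<phi> \<in> R. Z \<phi> = z}" if z: "z \<in> left_ends X" for z
  proof (rule countable_germs[where G = G and c = C and Y = Y])
    show "closed X" "z islimpt X" "\<And>s t. s < t \<Longrightarrow> \<not> {s..t} \<subseteq> X" "z \<in> left_ends X"
      using cantor_set_facts[OF X] z by (auto simp: left_ends_def)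
    fix \<phi> \<psi> assume phi: "\<phi> \<in> {\<phi> \<in> R. Z \<phi> = z}" and psi: "\<psi> \<in> {\<phi> \<in> R. Z \<phi> = z}" and "\<phi> \<noteq> \<psi>"
    show "\<not> (\<forall>\<^sub>F x in nhds z. G \<phi> x = G \<psi> x)"
    proof
      assume "\<forall>\<^sub>F x in nhds z. G \<phi> x = G \<psi> x"
      then have "G \<phi> x = G \<psi> x" if "x \<in> I" for x
        using real_analytic_identity[OF I GZC(1) GZC(1), of \<phi> \<psi> z x] GZC(4)[of \<phi>] phi psi that by auto
      then have "\<phi> x = \<psi> x" if "x \<in> X \<inter> I" for x
        using GZC(2)[of \<phi>] GZC(2)[of \<psi>] phi psi that by auto
      moreover have "\<phi> \<in> extensional (X \<inter> I)" "\<psi> \<in> extensional (X \<inter> I)"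
        using phi psi unfolding R_def by auto
      ultimately have "\<phi> = \<psi>" by (rule extensionalityI[rotated 2])
      then show False using \<open>\<phi> \<noteq> \<psi>\<close> by contradiction
    qed
  qed (use GZC in auto)
  then have "countable (\<Union>z\<in>left_ends X. {\<phi> \<in> R. Z \<phi> = z})"
    by (rule countable_UN[OF countable_left_ends])
  moreover have "R \<subseteq> (\<Union>z\<in>left_ends X. {\<phi> \<in> R. Z \<phi> = z})" using GZC(3) by auto
  ultimately show ?thesis unfolding R_def[symmetric] by (rule countable_subset[rotated])
qed

theorem corollary1p2:
  fixes X Y :: "real set"
  assumes "cantor_set X" and "cantor_set Y"
  shows "countable {f \<in> X \<rightarrow>\<^sub>E Y.
           (\<exists>F. finite F \<and> F \<subseteq> X \<and> open_map (top_of_set (X - F)) (top_of_set Y) f) \<and>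
           (\<exists>U g. open U \<and> X \<subseteq> U \<and> g real_analytic_on U \<and> (\<forall>x \<in> X. g x = f x))}"
    (is "countable ?M")
proof -
  \<comment> \<open>The neighbourhood of \<open>X\<close> need not be connected, so a single germ does not determine
    \<open>f\<close>. By compactness finitely many rational intervals inside it cover \<open>X\<close>, and there
    are only countably many such covers.\<close>
  define B :: "real set set" where "B = (\<lambda>(s, t). {s<..<t}) ` (\<rat> \<times> \<rat>)"
  define extends_over where
    "extends_over I f \<longleftrightarrow> (\<exists>g. g real_analytic_on I \<and> (\<forall>x \<in> X \<inter> I. g x = f x))" for I f
  define N where "N \<I> = {f \<in> ?M. \<forall>I\<in>\<I>. extends_over I f}" for \<I>
  have "countable B" unfolding B_def by (intro countable_image countable_SIGMA countable_rat)
  then have countC: "countable {\<I>. finite \<I> \<and> \<I> \<subseteq> B}" by (rule countable_Collect_finite_subset)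
  have "countable (N \<I>)" if \<I>: "finite \<I>" "\<I> \<subseteq> B" "X \<subseteq> \<Union>\<I>" for \<I>
  proof -
    define \<rho> where "\<rho> f = (\<lambda>I\<in>\<I>. restrict f (X \<inter> I))" for f :: "real \<Rightarrow> real"
    have "\<rho> ` N \<I> \<subseteq> (\<Pi>\<^sub>E I\<in>\<I>. (\<lambda>f. restrict f (X \<inter> I)) ` N \<I>)"
      unfolding \<rho>_def by auto
    moreover have "countable ((\<lambda>f. restrict f (X \<inter> I)) ` N \<I>)" if "I \<in> \<I>" for I
    proof (rule countable_restrictions[OF assms])
      show "open I" "connected I" using that \<I>(2) unfolding B_def by auto
      fix f assume f: "f \<in> N \<I>"
      then have fM: "f \<in> ?M" and "extends_over I f" using that unfolding N_def by blast+
      then show "\<exists>g. g real_analytic_on I \<and> (\<forall>x \<in> X \<inter> I. g x = f x)"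
        by (simp only: extends_over_def)
      show "f \<in> X \<rightarrow> Y" using fM by (simp add: PiE_iff)
      show "\<exists>F. finite F \<and> open_map (top_of_set (X - F)) (top_of_set Y) f" using fM by blast
    qed
    then have "countable (\<Pi>\<^sub>E I\<in>\<I>. (\<lambda>f. restrict f (X \<inter> I)) ` N \<I>)"
      using \<I>(1) by (intro countable_PiE)
    ultimately have "countable (\<rho> ` N \<I>)" by (rule countable_subset)
    moreover have "inj_on \<rho> (N \<I>)"
    proof (rule inj_onI)
      fix f h assume fh: "f \<in> N \<I>" "h \<in> N \<I>" "\<rho> f = \<rho> h"
      have "f x = h x" if x: "x \<in> X" for x
      proof -
        obtain I where I: "I \<in> \<I>" "x \<in> I" using \<I>(3) x by blast
        have "restrict f (X \<inter> I) = restrict h (X \<inter> I)"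
          using fun_cong[OF fh(3), of I] I(1) unfolding \<rho>_def by simp
        from fun_cong[OF this, of x] show ?thesis using x I(2) by simp
      qed
      moreover have "f \<in> X \<rightarrow>\<^sub>E Y" "h \<in> X \<rightarrow>\<^sub>E Y" using fh(1,2) unfolding N_def by blast+
      ultimately show "f = h" by (intro PiE_ext)
    qed
    ultimately show ?thesis by (rule countable_image_inj_on)
  qed
  then have "countable (\<Union>\<I>\<in>{\<I>. finite \<I> \<and> \<I> \<subseteq> B} \<inter> {\<I>. X \<subseteq> \<Union>\<I>}. N \<I>)"
    by (intro countable_UN countable_subset[OF _ countC]) auto
  moreover have "?M \<subseteq> (\<Union>\<I>\<in>{\<I>. finite \<I> \<and> \<I> \<subseteq> B} \<inter> {\<I>. X \<subseteq> \<Union>\<I>}. N \<I>)"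
  proof
    fix f assume f: "f \<in> ?M"
    then obtain U g where Ug: "open U" "X \<subseteq> U" "g real_analytic_on U" "\<And>x. x \<in> X \<Longrightarrow> g x = f x"
      by blast
    define \<C> where "\<C> = {I \<in> B. I \<subseteq> U}"
    have "\<exists>I\<in>\<C>. x \<in> I" if x: "x \<in> X" for x
    proof -
      obtain e where e: "e > 0" "ball x e \<subseteq> U" using Ug(1,2) x open_contains_ball by blast
      obtain s t where "s \<in> \<rat>" "x - e < s" "s < x" "t \<in> \<rat>" "x < t" "t < x + e"
        using Rats_dense_in_real[of "x - e" x] Rats_dense_in_real[of x "x + e"] e(1) by auto
      moreover from this have "{s<..<t} \<subseteq> ball x e" by (auto simp: dist_real_def)
      ultimately show ?thesis
        using e(2) unfolding \<C>_def B_def by (intro bexI[of _ "{s<..<t}"]) auto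
    qed
    then have cover: "X \<subseteq> \<Union>\<C>" by blast
    have "\<And>I. I \<in> \<C> \<Longrightarrow> open I" unfolding \<C>_def B_def by auto
    moreover have "compact X" using assms(1) by (simp add: cantor_set_def)
    ultimately obtain \<I> where \<I>: "\<I> \<subseteq> \<C>" "finite \<I>" "X \<subseteq> \<Union>\<I>"
      using compactE[OF _ cover] by metis
    have "extends_over I f" if "I \<in> \<I>" for I
      unfolding extends_over_def
    proof (intro exI[of _ g] conjI)
      have "I \<subseteq> U" using that \<I>(1) unfolding \<C>_def by blast
      then show "g real_analytic_on I" using Ug(3) unfolding real_analytic_on_def by blast
    qed (use Ug(4) in blast)
    then have "f \<in> N \<I>" unfolding N_def using f by blast
    moreover have "\<I> \<subseteq> B" using \<I>(1) unfolding \<C>_def by blast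
    ultimately show "f \<in> (\<Union>\<I>\<in>{\<I>. finite \<I> \<and> \<I> \<subseteq> B} \<inter> {\<I>. X \<subseteq> \<Union>\<I>}. N \<I>)"
      using \<I>(2,3) by (intro UN_I[of \<I>]) simp_all
  qed
  ultimately show ?thesis by (rule countable_subset[rotated])
qed

end
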